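(* Let $G$ be a finite group. Then $G$ is uniformly generated if and only if one of the following holds: (i) there are a prime $p$ and an integer $d\geq 0$ such that $G\cong (\mathrm{C}_p)^d$ is elementary abelian; or (ii) there are primes $p,q$ and an integer $d\geq 2$ such that $G\cong (\mathrm{C}_p)^{d-1}\rtimes \mathrm{C}_q$, where $\mathrm{C}_q$ acts as a nontrivial scalar on $(\mathrm{C}_p)^{d-1}$.
   Context: $\mathrm{C}_n$ denotes a cyclic group of order $n$. For a finite group $G$, $d(G)$ denotes the minimal number of generators of $G$ (so $d(1)=0$). A finite group $G$ is called uniformly generated if, with $d=d(G)$, for every tuple $(x_1,\dots,x_d)\in G^d$ satisfying the strictly ascending chain condition $1<\langle x_1\rangle<\langle x_1,x_2\rangle<\cdots<\langle x_1,x_2,\dots,x_d\rangle$ one has $G=\langle x_1,x_2,\dots,x_d\rangle$. Regard $(\mathrm{C}_p)^{d-1}$ as a vector space over the field $\mathbb{F}_p$ of $p$ elements; "$\mathrm{C}_q$ acts as a nontrivial scalar on $(\mathrm{C}_p)^{d-1}$" means that a generator of $\mathrm{C}_q$ acts on $(\mathrm{C}_p)^{d-1}$ as multiplication by some scalar $\lambda\in\mathbb{F}_p^{\times}$ with $\lambda\neq 1$ (equivalently, in multiplicative notation, as $v\mapsto v^{k}$ for a fixed integer $k$ with $k\not\equiv 0,1 \pmod p$). *)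

theory Defs
  imports "HOL-Algebra.Algebra" "HOL-Number_Theory.Cong"
begin

definition min_generators :: "('a, 'b) monoid_scheme \<Rightarrow> nat" where
  "min_generators G =
     (LEAST n. \<exists>S. S \<subseteq> carrier G \<and> finite S \<and> card S = n \<and> generate G S = carrier G)"

text \<open>Tuples in \<open>G\<^sup>d\<close> are lists of length \<open>d\<close>.  The \<open>i = 0\<close> instance of the chain condition
  is the initial inclusion of the trivial subgroup, as \<open>generate G {}\<close> is \<open>{\<one>}\<close>.\<close>

definition uniformly_generated :: "('a, 'b) monoid_scheme \<Rightarrow> bool" where
  "uniformly_generated G \<longleftrightarrow>
     (\<forall>xs. length xs = min_generators G \<and> set xs \<subseteq> carrier G \<and>
        (\<forall>i < length xs. generate G (set (take i xs)) \<subset> generate G (set (take (Suc i) xs)))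
        \<longrightarrow> generate G (set xs) = carrier G)"

definition cyclic_power :: "nat \<Rightarrow> nat \<Rightarrow> (nat \<Rightarrow> int) monoid" where
  "cyclic_power p n = product_group {..<n} (\<lambda>_. integer_mod_group p)"

definition semidirect_product ::
    "('a, 'c) monoid_scheme \<Rightarrow> ('b, 'd) monoid_scheme \<Rightarrow> ('b \<Rightarrow> 'a \<Rightarrow> 'a) \<Rightarrow> ('a \<times> 'b) monoid" where
  "semidirect_product N H \<phi> =
     \<lparr>carrier = carrier N \<times> carrier H,
      monoid.mult = (\<lambda>(n, h) (n', h'). (n \<otimes>\<^bsub>N\<^esub> \<phi> h n', h \<otimes>\<^bsub>H\<^esub> h')),
      one = (\<one>\<^bsub>N\<^esub>, \<one>\<^bsub>H\<^esub>)\<rparr>"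

text \<open>On \<open>(C\<^sub>p)\<^sup>n\<close>, multiplication by the residue class of \<open>k\<close> is the power map \<open>v \<mapsto> v [^] k\<close>.
  The condition does not depend on the choice of the generator \<open>c\<close>, when \<open>\<phi>\<close> is an action.\<close>

definition acts_as_nontrivial_scalar ::
    "nat \<Rightarrow> nat \<Rightarrow> nat \<Rightarrow> (int \<Rightarrow> (nat \<Rightarrow> int) \<Rightarrow> nat \<Rightarrow> int) \<Rightarrow> bool" where
  "acts_as_nontrivial_scalar p n q \<phi> \<longleftrightarrow>
     (\<exists>c \<in> carrier (integer_mod_group q).
        generate (integer_mod_group q) {c} = carrier (integer_mod_group q) \<and>
        (\<exists>k::int. \<not> [k = 0] (mod int p) \<and> \<not> [k = 1] (mod int p) \<and>
           (\<forall>v \<in> carrier (cyclic_power p n). \<phi> c v = v [^]\<^bsub>cyclic_power p n\<^esub> k)))"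

lemma group_cyclic_power: "group (cyclic_power p n)"
  by (simp add: cyclic_power_def)

lemma group_semidirect_product:
  assumes N: "group N" and H: "group H" and \<phi>: "\<phi> \<in> hom H (AutoGroup N)"
  shows "group (semidirect_product N H \<phi>)"
proof -
  interpret N: group N by (rule N)
  interpret H: group H by (rule H)
  interpret \<phi>: group_hom H "AutoGroup N" \<phi>
    using H N.AutoGroup \<phi> by (simp add: group_hom_def group_hom_axioms_def)
  have auto: "\<phi> h \<in> auto N" if "h \<in> carrier H" for h
    using \<phi>.hom_closed[OF that] by (simp add: AutoGroup_def)
  have hom: "\<phi> h \<in> hom N N" if "h \<in> carrier H" for h
    using auto[OF that] by (simp add: auto_def)
  have cl: "\<phi> h x \<in> carrier N" if "h \<in> carrier H" "x \<in> carrier N" for h x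
    using hom_in_carrier[OF hom] that by blast
  have mult: "\<phi> h (x \<otimes>\<^bsub>N\<^esub> y) = \<phi> h x \<otimes>\<^bsub>N\<^esub> \<phi> h y"
    if "h \<in> carrier H" "x \<in> carrier N" "y \<in> carrier N" for h x y
    using hom_mult[OF hom] that by blast
  have comp: "\<phi> (h \<otimes>\<^bsub>H\<^esub> k) x = \<phi> h (\<phi> k x)"
    if "h \<in> carrier H" "k \<in> carrier H" "x \<in> carrier N" for h k x
    using that auto by (simp add: AutoGroup_def BijGroup_def auto_def compose_eq)
  have one: "\<phi> \<one>\<^bsub>H\<^esub> x = x" if "x \<in> carrier N" for x
    using that \<phi>.hom_one by (simp add: AutoGroup_def BijGroup_def)
  show ?thesis
  proof (rule groupI)
    fix a assume "a \<in> carrier (semidirect_product N H \<phi>)"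
    then obtain x h where a: "a = (x, h)" "x \<in> carrier N" "h \<in> carrier H"
      by (auto simp: semidirect_product_def)
    let ?b = "(\<phi> (inv\<^bsub>H\<^esub> h) (inv\<^bsub>N\<^esub> x), inv\<^bsub>H\<^esub> h)"
    have "\<phi> (inv\<^bsub>H\<^esub> h) (inv\<^bsub>N\<^esub> x) \<otimes>\<^bsub>N\<^esub> \<phi> (inv\<^bsub>H\<^esub> h) x = \<phi> (inv\<^bsub>H\<^esub> h) \<one>\<^bsub>N\<^esub>"
      using a by (simp del: \<phi>.hom_inv flip: mult)
    also have "\<dots> = \<one>\<^bsub>N\<^esub>"
      using a by (intro hom_one[OF hom N N]) simp
    finally show "\<exists>b \<in> carrier (semidirect_product N H \<phi>).
        b \<otimes>\<^bsub>semidirect_product N H \<phi>\<^esub> a = \<one>\<^bsub>semidirect_product N H \<phi>\<^esub>"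
      using a by (intro bexI[of _ ?b]) (auto simp: semidirect_product_def cl simp del: \<phi>.hom_inv)
  qed (auto simp: semidirect_product_def cl mult comp one N.m_assoc H.m_assoc
      simp del: \<phi>.hom_mult \<phi>.hom_one)
qed

end

theory Submission
  imports Defs "HOL-Number_Theory.Pocklington"
begin

text \<open>
  Write \<open>d\<close> for the minimal number of generators of a finite group \<open>G\<close>. Choosing one element from each step
  of a chain of subgroups shows that \<open>G\<close> is uniformly generated exactly when no strictly ascending
  chain of subgroups of \<open>G\<close> has more than \<open>d\<close> steps: a chain of \<open>d\<close> steps that stops short of \<open>G\<close> can be
  continued, and in a longer chain the subgroup at step \<open>d\<close> is not \<open>G\<close>.

  Suppose that \<open>G\<close> is uniformly generated. The bound on chains is inherited by subgroups: in a subgroup generated by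
  \<open>k\<close> elements every strict chain has at most \<open>k\<close> steps, because a longer one could be extended to a maximal
  chain of \<open>G\<close>, and replacing its beginning by the \<open>k\<close> elements would give a generating set with fewer than \<open>d\<close> elements
  (\<open>uniformly_generated_chain_bound\<close>). For \<open>k = 1\<close> this says that every nontrivial element has
  prime order. For \<open>k = 2\<close> it says that in \<open>\<langle>x, y\<rangle>\<close> every proper nontrivial subgroup is both minimal and maximal.
  Such a group has a nontrivial normal cyclic subgroup: otherwise each
  subgroup of prime order is its own normalizer, so that its conjugates cover at least half of the group, and two
  classes of conjugates do not fit (\<open>length_two_imp_normal_cyclic\<close>). Let \<open>p\<close> be the largest
  order of an element. The normal cyclic subgroup of \<open>\<langle>x, y\<rangle>\<close> and Fermat's little theorem show that every \<open>y\<close> normalizes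
  \<open>\<langle>x\<rangle>\<close> when \<open>x\<^sup>p = 1\<close> (\<open>maximal_order_cyclic_normal\<close>). Hence \<open>N = {x. x\<^sup>p = 1}\<close> is an abelian
  normal subgroup on which \<open>G\<close> acts by power maps, and the bound for two elements also shows that the elements
  outside \<open>N\<close> generate each other modulo \<open>N\<close>.

  These properties of \<open>N\<close> form the predicate \<open>scalar_kernel\<close>, through which both implications pass.
  Normal subgroups of prime order commute pairwise, so \<open>N\<close> is elementary abelian, and the exponents of the
  power maps are the same on all of \<open>N\<close>. Either \<open>G\<close> is abelian, and then elementary abelian, or
  \<open>G = N \<langle>y\<rangle>\<close> with \<open>y\<close> of prime order acting as a nontrivial scalar
  (\<open>scalar_kernel_classification\<close>).

  Conversely, the two families have a scalar kernel, and in a group with a scalar kernel adding one generator to a subgroup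
  \<open>H\<close> multiplies its order by \<open>1\<close> or by a prime (\<open>scalar_kernel_card_generate_insert\<close>). The number of
  prime factors of the order, with multiplicity, is therefore a rank: \<open>k\<close> elements generate a subgroup
  of rank at most \<open>k\<close>, while every strict step of a chain raises the rank. A strict chain with \<open>d\<close> steps has at
  least the rank of \<open>G\<close>, so it ends in \<open>G\<close>.
\<close>

section \<open>Powers, conjugation and elements of prime order\<close>

lemma (in group) generate_singleton_nat:
  assumes "finite (carrier G)" "a \<in> carrier G" "b \<in> generate G {a}"
  obtains k :: nat where "b = a [^] k"
  using generate_pow_nat[OF assms(2)] assms ord_ge_1 by fastforce

lemma (in group) generate_singletonE:
  assumes "a \<in> carrier G" "b \<in> generate G {a}"
  obtains k :: int where "b = a [^] k"
  using generate_pow[OF assms(1)] assms(2) by blast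

lemma (in group) int_pow_in_generate:
  assumes "a \<in> carrier G"
  shows "a [^] (k::int) \<in> generate G {a}"
  using generate_pow[OF assms] by blast

lemma (in group) nat_pow_in_generate:
  assumes "a \<in> carrier G"
  shows "a [^] (k::nat) \<in> generate G {a}"
  using int_pow_in_generate[OF assms, of "int k"] by (simp add: int_pow_int)

lemma (in group) conj_int_pow:
  assumes "g \<in> carrier G" "x \<in> carrier G"
  shows "(g \<otimes> x \<otimes> inv g) [^] (k::int) = g \<otimes> x [^] k \<otimes> inv g"
proof -
  have "(\<lambda>y. g \<otimes> y \<otimes> inv g) \<in> hom G G"
    using assms(1) by (auto intro!: homI simp: m_assoc) (simp add: m_assoc[symmetric])
  then show ?thesis
    using hom_int_pow[OF _ assms(2) is_group is_group] by fastforce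
qed

text \<open>
  An exponent prime to \<open>r\<close> is invertible modulo \<open>r\<close>, so \<open>x\<close> is a power of \<open>x [^] k\<close>.
\<close>

lemma (in group) subgroup_mem_if_pow_mem:
  fixes r :: nat and k :: int
  assumes H: "subgroup H G" and x: "x \<in> carrier G" and r: "Factorial_Ring.prime r" "x [^] r = \<one>"
    and k: "\<not> int r dvd k" "x [^] k \<in> H"
  shows "x \<in> H"
proof -
  have "coprime k (int r)"
    using r k by (metis coprime_commute prime_imp_coprime prime_nat_int_transfer)
  then obtain u where u: "[k * u = 1] (mod int r)"
    using cong_solve_coprime_int by blast
  then have "int r dvd k * u - 1"
    by (simp add: cong_iff_dvd_diff)
  then have "x [^] (k * u) = x [^] (1::int)"
    using int_pow_eq[OF x] r x pow_eq_id
    by (metis dvd_trans int_dvd_int_iff)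
  then have "(x [^] k) [^] u = x"
    using x by (simp add: int_pow_pow)
  then show ?thesis
    using subgroup_int_pow_closed[OF H k(2)] by metis
qed

lemma (in group) prime_cyclic_generate_eq:
  fixes r :: nat
  assumes x: "x \<in> carrier G" and r: "Factorial_Ring.prime r" "x [^] r = \<one>"
    and b: "b \<in> generate G {x}" "b \<noteq> \<one>"
  shows "generate G {b} = generate G {x}"
proof -
  obtain k :: int where k: "b = x [^] k"
    using generate_singletonE[OF x b(1)] by blast
  have "\<not> int r dvd k"
    using b(2) k r x by (metis dvdE int_pow_int int_pow_one int_pow_pow)
  moreover have "b \<in> carrier G" using k x by simp
  moreover have "b \<in> generate G {b}" by (simp add: generate.incl)
  ultimately have "x \<in> generate G {b}"
    using subgroup_mem_if_pow_mem[OF generate_is_subgroup _ r, of "{b}" k] x k by simp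
  then show ?thesis
    using b \<open>b \<in> carrier G\<close> x
    by (intro equalityI generate_subgroup_incl generate_is_subgroup) auto
qed

text \<open>
  The commutator of \<open>x\<close> and \<open>y\<close> lies in both cyclic subgroups. These have prime order, so either they meet
  trivially and the commutator vanishes, or they coincide.
\<close>

lemma (in group) normal_prime_cyclic_commute:
  fixes r s :: nat
  assumes x: "x \<in> carrier G" and y: "y \<in> carrier G"
    and r: "Factorial_Ring.prime r" "x [^] r = \<one>"
    and s: "Factorial_Ring.prime s" "y [^] s = \<one>"
    and xy: "x \<otimes> y \<otimes> inv x \<in> generate G {y}"
    and yx: "y \<otimes> x \<otimes> inv y \<in> generate G {x}"
  shows "x \<otimes> y = y \<otimes> x"
proof -
  let ?w = "x \<otimes> y \<otimes> inv x \<otimes> inv y"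
  have sx: "subgroup (generate G {x}) G" and sy: "subgroup (generate G {y}) G"
    using x y by (auto intro: generate_is_subgroup)
  have gx: "x \<in> generate G {x}" and gy: "y \<in> generate G {y}"
    by (auto intro: generate.incl)
  have wy: "?w \<in> generate G {y}"
    using subgroup.m_closed[OF sy xy] subgroup.m_inv_closed[OF sy gy] by blast
  have "?w = x \<otimes> inv (y \<otimes> x \<otimes> inv y)"
    using x y by (simp add: inv_mult_group m_assoc)
  then have wx: "?w \<in> generate G {x}"
    using subgroup.m_closed[OF sx gx subgroup.m_inv_closed[OF sx yx]] by simp
  show ?thesis
  proof (cases "?w = \<one>")
    case True
    have "x \<otimes> y = ?w \<otimes> (y \<otimes> x)"
      using x y by (simp add: m_assoc) (simp add: m_assoc[symmetric])
    then show ?thesis using True x y by simp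
  next
    case False
    then have "generate G {x} = generate G {y}"
      using prime_cyclic_generate_eq[OF x r wx] prime_cyclic_generate_eq[OF y s wy] by simp
    then obtain k :: int where "y = x [^] k"
      using gy generate_singletonE[OF x] by metis
    then show ?thesis
      using x by (metis int_pow_1 int_pow_mult add.commute)
  qed
qed

text \<open>
  Two commuting elements of different prime orders would have a product whose order is composite.
\<close>

lemma (in group) commuting_same_prime_exponent:
  fixes p :: nat
  assumes prm: "\<And>x. x \<in> carrier G \<Longrightarrow> \<exists>r::nat. Factorial_Ring.prime r \<and> x [^] r = \<one>"
    and a: "a \<in> carrier G" "a \<noteq> \<one>" "a [^] p = \<one>" "Factorial_Ring.prime p"
    and b: "b \<in> carrier G" "a \<otimes> b = b \<otimes> a"
  shows "b [^] p = \<one>"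
proof (rule ccontr)
  assume nb: "b [^] p \<noteq> \<one>"
  obtain s :: nat where s: "Factorial_Ring.prime s" "b [^] s = \<one>" using prm b by blast
  obtain t :: nat where t: "Factorial_Ring.prime t" "(a \<otimes> b) [^] t = \<one>" using prm a b by blast
  have dist: "(a \<otimes> b) [^] n = a [^] n \<otimes> b [^] n" for n :: nat
    using pow_mult_distrib a b by blast
  have oa: "a [^] n = \<one> \<longleftrightarrow> p dvd n" for n :: nat
    using a by (metis pow_eq_id ord_eq_1 prime_nat_iff)
  have ob: "b [^] n = \<one> \<longleftrightarrow> s dvd n" for n :: nat
    using b s nb by (metis pow_eq_id ord_eq_1 prime_nat_iff nat_pow_one)
  have ps: "p \<noteq> s" using nb s by blast
  have "(a \<otimes> b) [^] (t * p) = \<one>" "(a \<otimes> b) [^] (t * s) = \<one>"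
    using t a b by (simp_all add: nat_pow_pow[symmetric])
  moreover have "a [^] (t * p) = \<one>" "b [^] (t * s) = \<one>"
    using oa ob by auto
  ultimately have "b [^] (t * p) = \<one>" "a [^] (t * s) = \<one>"
    using dist a b by (metis l_one nat_pow_closed, metis r_one nat_pow_closed)
  then have "s dvd t * p" "p dvd t * s"
    using oa ob by auto
  then have "s dvd t" "p dvd t"
    using ps a(4) s(1) by (metis prime_dvd_mult_iff primes_dvd_imp_eq)+
  then show False
    using ps a(4) s(1) t(1) by (metis primes_dvd_imp_eq)
qed

lemma (in group) commuting_elements_common_prime_exponent:
  assumes N: "N \<subseteq> carrier G" and comm: "\<And>x y. \<lbrakk>x \<in> N; y \<in> N\<rbrakk> \<Longrightarrow> x \<otimes> y = y \<otimes> x"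
    and prm: "\<And>x. x \<in> carrier G \<Longrightarrow> \<exists>r::nat. Factorial_Ring.prime r \<and> x [^] r = \<one>"
  shows "\<exists>p::nat. Factorial_Ring.prime p \<and> (\<forall>x \<in> N. x [^] p = \<one>)"
proof (cases "N \<subseteq> {\<one>}")
  case True
  then show ?thesis using two_is_prime_nat by (intro exI[of _ 2]) auto
next
  case False
  then obtain a where a: "a \<in> N" "a \<noteq> \<one>" by blast
  then obtain p :: nat where p: "Factorial_Ring.prime p" "a [^] p = \<one>" using prm N by blast
  have "x [^] p = \<one>" if "x \<in> N" for x
    using commuting_same_prime_exponent[OF prm _ a(2) p(2,1), of x] a N comm that by blast
  then show ?thesis using p by blast
qed

lemma (in group) commutation_pow_right:
  assumes g: "g \<in> carrier G" and x: "x \<in> carrier G" and eq: "g \<otimes> x = x [^] (k::int) \<otimes> g"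
  shows "g \<otimes> x [^] (i::int) = x [^] (k * i) \<otimes> g"
proof -
  have "g \<otimes> x \<otimes> inv g = x [^] k" using eq g x by (simp add: m_assoc)
  then have "g \<otimes> x [^] i \<otimes> inv g = x [^] (k * i)"
    using conj_int_pow[OF g x, of i] x by (simp add: int_pow_pow)
  then show ?thesis using g x by (metis inv_solve_right' int_pow_closed m_closed)
qed

lemma (in group) commutation_pow_left:
  assumes g: "g \<in> carrier G" and x: "x \<in> carrier G" and eq: "g \<otimes> x = x [^] (k::int) \<otimes> g"
  shows "g [^] (j::nat) \<otimes> x = x [^] (k ^ j) \<otimes> g [^] j"
proof (induction j)
  case (Suc j)
  have "g [^] Suc j \<otimes> x = (g [^] j \<otimes> x [^] k) \<otimes> g"
    using g x eq by (simp add: m_assoc)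
  also have "g [^] j \<otimes> x [^] k = x [^] (k ^ j * k) \<otimes> g [^] j"
    by (rule commutation_pow_right) (use g x Suc.IH in auto)
  finally show ?case using g x by (simp add: m_assoc mult.commute)
qed (use x in simp)

lemma (in group) conj_eqD:
  assumes "g \<in> carrier G" "h \<in> carrier G" "x \<in> carrier G" "z \<in> carrier G"
    and eq: "g \<otimes> x \<otimes> inv g = h \<otimes> z \<otimes> inv h"
  shows "x = (inv g \<otimes> h) \<otimes> z \<otimes> inv (inv g \<otimes> h)"
proof -
  have "x = inv g \<otimes> (g \<otimes> x \<otimes> inv g) \<otimes> g"
    using assms(1,3) by (simp add: m_assoc) (simp add: m_assoc[symmetric])
  also have "\<dots> = (inv g \<otimes> h) \<otimes> z \<otimes> inv (inv g \<otimes> h)"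
    unfolding eq using assms(1-4) by (simp add: inv_mult_group m_assoc)
  finally show ?thesis .
qed

lemma (in group) cross_cancel:
  assumes "a \<in> carrier G" "b \<in> carrier G" "c \<in> carrier G" "d \<in> carrier G"
    and eq: "a \<otimes> b = c \<otimes> d"
  shows "inv c \<otimes> a = d \<otimes> inv b"
proof -
  have "a = (a \<otimes> b) \<otimes> inv b"
    using assms(1-4) by (simp add: m_assoc)
  also have "\<dots> = c \<otimes> (d \<otimes> inv b)"
    unfolding eq using assms(1-4) by (simp add: m_assoc)
  finally show ?thesis
    using assms(1-4) inv_solve_left[of "d \<otimes> inv b" c a] by simp
qed

text \<open>
  To send the generator \<open>x\<close> into \<open>\<langle>x\<rangle>\<close> is already to normalize \<open>\<langle>x\<rangle>\<close>, since the
  image is again a generator. In this form the normalizer can be tested on a single element.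
\<close>

lemma (in group) normalizer_of_prime_cyclic_subgroup:
  fixes r :: nat
  assumes x: "x \<in> carrier G" and r: "Factorial_Ring.prime r" "x [^] r = \<one>"
  shows "subgroup {g \<in> carrier G. g \<otimes> x \<otimes> inv g \<in> generate G {x}} G" (is "subgroup ?S G")
proof (rule subgroupI)
  show "?S \<subseteq> carrier G" by blast
  have "\<one> \<in> ?S" using x by (simp add: generate.incl)
  then show "?S \<noteq> {}" by blast
next
  fix g assume "g \<in> ?S"
  then have g: "g \<in> carrier G" "g \<otimes> x \<otimes> inv g \<in> generate G {x}" by auto
  show "inv g \<in> ?S"
  proof (cases "x = \<one>")
    case False
    then have "g \<otimes> x \<otimes> inv g \<noteq> \<one>"
      using g(1) x by (metis inv_equality inv_inv inv_solve_right' l_cancel_one' r_one inv_closed m_closed)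
    then have "x \<in> generate G {g \<otimes> x \<otimes> inv g}"
      using prime_cyclic_generate_eq[OF x r g(2)] by (simp add: generate.incl)
    then obtain k :: int where "x = (g \<otimes> x \<otimes> inv g) [^] k"
      using generate_singletonE g x by (metis inv_closed m_closed)
    then have "\<one> \<otimes> x \<otimes> inv \<one> = g \<otimes> x [^] k \<otimes> inv g"
      using conj_int_pow g x by simp
    then have "x [^] k = inv g \<otimes> x \<otimes> g"
      using conj_eqD[of g \<one> "x [^] k" x] g x by simp
    then show ?thesis
      using g x int_pow_in_generate[OF x, of k] by simp
  qed (use g generate.one in simp)
next
  fix g h assume "g \<in> ?S" "h \<in> ?S"
  then have g: "g \<in> carrier G" "g \<otimes> x \<otimes> inv g \<in> generate G {x}"
    and h: "h \<in> carrier G" "h \<otimes> x \<otimes> inv h \<in> generate G {x}" by auto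
  obtain k :: int where k: "h \<otimes> x \<otimes> inv h = x [^] k" using generate_singletonE[OF x h(2)] by blast
  have "(g \<otimes> h) \<otimes> x \<otimes> inv (g \<otimes> h) = g \<otimes> (h \<otimes> x \<otimes> inv h) \<otimes> inv g"
    using g h x by (simp add: inv_mult_group m_assoc)
  also have "\<dots> = (g \<otimes> x \<otimes> inv g) [^] k"
    using k conj_int_pow g x by simp
  also have "\<dots> \<in> generate G {x}"
    using subgroup_int_pow_closed[OF generate_is_subgroup g(2)] x by simp
  finally show "g \<otimes> h \<in> ?S" using g h by simp
qed

lemma (in group) normal_if_conj_powers:
  assumes N: "subgroup N G"
    and c: "\<And>x g. \<lbrakk>x \<in> N; g \<in> carrier G\<rbrakk> \<Longrightarrow> \<exists>k::int. g \<otimes> x = x [^] k \<otimes> g"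
    shows "N \<lhd> G"
  unfolding normal_inv_iff
proof (intro conjI ballI N)
  fix g x assume g: "g \<in> carrier G" and x: "x \<in> N"
  then have xc: "x \<in> carrier G" using subgroup.subset[OF N] by blast
  obtain k :: int where "g \<otimes> x = x [^] k \<otimes> g" using c[OF x g] by blast
  then have "g \<otimes> x \<otimes> inv g = x [^] k" using g xc by (simp add: m_assoc)
  then show "g \<otimes> x \<otimes> inv g \<in> N" using subgroup_int_pow_closed[OF N x] by simp
qed

section \<open>Strictly ascending chains in uniformly generated groups\<close>

text \<open>
  This is the hypothesis on a tuple in \<open>uniformly_generated\<close>, without the condition on its
  length, so that chains can be extended and cut.
\<close>

definition strict_chain :: "('a, 'b) monoid_scheme \<Rightarrow> 'a list \<Rightarrow> bool" where
  "strict_chain G xs \<longleftrightarrow> set xs \<subseteq> carrier G \<and>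
     (\<forall>i < length xs. generate G (set (take i xs)) \<subset> generate G (set (take (Suc i) xs)))"

lemma uniformly_generated_iff_strict_chain:
  "uniformly_generated G \<longleftrightarrow>
     (\<forall>xs. strict_chain G xs \<and> length xs = min_generators G \<longrightarrow> generate G (set xs) = carrier G)"
  unfolding uniformly_generated_def strict_chain_def by blast

lemma strict_chain_Nil [simp]: "strict_chain G []"
  by (simp add: strict_chain_def)

lemma (in group) strict_chain_snoc:
  "strict_chain G (xs @ [x]) \<longleftrightarrow>
     strict_chain G xs \<and> x \<in> carrier G \<and> x \<notin> generate G (set xs)"
proof -
  have step: "generate G (set xs) \<subset> generate G (insert x (set xs)) \<longleftrightarrow> x \<notin> generate G (set xs)"
    if "set xs \<subseteq> carrier G" "x \<in> carrier G"
  proof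
    assume "generate G (set xs) \<subset> generate G (insert x (set xs))"
    moreover have "generate G (insert x (set xs)) \<subseteq> generate G (set xs)"
      if "x \<in> generate G (set xs)"
      using that \<open>set xs \<subseteq> carrier G\<close>
      by (intro generate_subgroup_incl generate_is_subgroup) (auto intro: generate.incl)
    ultimately show "x \<notin> generate G (set xs)" by blast
  next
    assume "x \<notin> generate G (set xs)"
    moreover have "x \<in> generate G (insert x (set xs))" by (simp add: generate.incl)
    moreover have "generate G (set xs) \<subseteq> generate G (insert x (set xs))"
      by (rule mono_generate) auto
    ultimately show "generate G (set xs) \<subset> generate G (insert x (set xs))" by blast
  qed
  show ?thesis
    using step by (auto simp: strict_chain_def less_Suc_eq)
qed

lemma (in group) strict_chain_appendD: "strict_chain G (xs @ ys) \<Longrightarrow> strict_chain G xs"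
proof (induction ys rule: rev_induct)
  case (snoc y ys)
  then show ?case
    using strict_chain_snoc[of "xs @ ys" y] by simp
qed simp

lemma (in group) strict_chain_extends:
  assumes "finite (carrier G)" "strict_chain G ys"
  shows "\<exists>us. strict_chain G (ys @ us) \<and> generate G (set (ys @ us)) = carrier G"
  using assms(2)
proof (induction "card (carrier G - generate G (set ys))" arbitrary: ys rule: less_induct)
  case less
  have sub: "set ys \<subseteq> carrier G" using less.prems by (simp add: strict_chain_def)
  then have gsub: "generate G (set ys) \<subseteq> carrier G" by (rule generate_incl)
  show ?case
  proof (cases "generate G (set ys) = carrier G")
    case True
    then show ?thesis using less.prems by (intro exI[of _ "[]"]) simp
  next
    case False
    then obtain x where x: "x \<in> carrier G" "x \<notin> generate G (set ys)" using gsub by blast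
    have ch: "strict_chain G (ys @ [x])" using x less.prems strict_chain_snoc by simp
    have "generate G (set ys) \<subseteq> generate G (set (ys @ [x]))"
      by (rule mono_generate) auto
    moreover have "x \<in> generate G (set (ys @ [x]))" by (simp add: generate.incl)
    ultimately have "carrier G - generate G (set (ys @ [x])) \<subset> carrier G - generate G (set ys)"
      using x by blast
    then have "card (carrier G - generate G (set (ys @ [x]))) < card (carrier G - generate G (set ys))"
      using assms(1) by (simp add: psubset_card_mono)
    from less.hyps[OF this ch] obtain us where
      "strict_chain G ((ys @ [x]) @ us)" "generate G (set ((ys @ [x]) @ us)) = carrier G" by blast
    then show ?thesis by (intro exI[of _ "x # us"]) simp
  qed
qed

lemma min_generators_le:
  assumes "set xs \<subseteq> carrier G" "generate G (set xs) = carrier G"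
  shows "min_generators G \<le> length xs"
proof -
  have "min_generators G \<le> card (set xs)"
    unfolding min_generators_def by (rule Least_le) (use assms in blast)
  then show ?thesis using card_length[of xs] by linarith
qed

text \<open>
  An exchange argument: extend \<open>ys\<close> by \<open>us\<close> to a chain that reaches \<open>G\<close>. Uniform generation bounds
  its length by the minimal number of generators, and \<open>xs @ us\<close> is a generating tuple, so it cannot be
  shorter than that number.
\<close>

lemma (in group) uniformly_generated_chain_bound:
  assumes fin: "finite (carrier G)" and ug: "uniformly_generated G"
    and ys: "strict_chain G ys" and xs: "set xs \<subseteq> carrier G" "set ys \<subseteq> generate G (set xs)"
  shows "length ys \<le> length xs"
proof -
  obtain us where us: "strict_chain G (ys @ us)" "generate G (set (ys @ us)) = carrier G"
    using strict_chain_extends[OF fin ys] by blast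
  define d where "d = min_generators G"
  define zs where "zs = ys @ us"
  have usc: "set us \<subseteq> carrier G" using us(1) by (simp add: strict_chain_def)
  have "length zs \<le> d"
  proof (rule ccontr)
    assume "\<not> length zs \<le> d"
    then have d: "d < length zs" by simp
    \<comment> \<open>The first \<open>d\<close> entries already generate \<open>G\<close>, so the next step would not be strict.\<close>
    then have zs_eq: "zs = (take d zs @ [zs ! d]) @ drop (Suc d) zs"
      using id_take_nth_drop by fastforce
    then have ch: "strict_chain G (take d zs @ [zs ! d])"
      using us(1) strict_chain_appendD zs_def by metis
    then have "strict_chain G (take d zs)" "zs ! d \<notin> generate G (set (take d zs))" "zs ! d \<in> carrier G"
      using strict_chain_snoc by auto
    moreover have "length (take d zs) = min_generators G" using d d_def by simp
    ultimately show False
      using ug uniformly_generated_iff_strict_chain by blast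
  qed
  moreover have "d \<le> length (xs @ us)"
    unfolding d_def
  proof (rule min_generators_le)
    show sub: "set (xs @ us) \<subseteq> carrier G" using xs usc by simp
    have "set (ys @ us) \<subseteq> generate G (set (xs @ us))"
      using xs(2) mono_generate[of "set xs" "set (xs @ us)"] by (auto intro: generate.incl)
    then have "carrier G \<subseteq> generate G (set (xs @ us))"
      using generate_subgroup_incl[OF _ generate_is_subgroup[OF sub]] us(2) by blast
    then show "generate G (set (xs @ us)) = carrier G"
      using generate_incl[OF sub] by blast
  qed
  ultimately show ?thesis by (simp add: zs_def)
qed

text \<open>
  For a prime divisor \<open>s\<close> of the order of \<open>x\<close>, the subgroup generated by \<open>x [^] s\<close> is proper
  in \<open>\<langle>x\<rangle>\<close>, where a strict chain has only one step; so \<open>x [^] s\<close> is trivial. The exponent \<open>r\<close> is left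
  arbitrary for \<open>x = \<one>\<close>, so that the statement covers all elements.
\<close>

lemma (in group) uniformly_generated_prime_exponent:
  assumes fin: "finite (carrier G)" and ug: "uniformly_generated G" and x: "x \<in> carrier G"
  shows "\<exists>r::nat. Factorial_Ring.prime r \<and> x [^] r = \<one>"
proof (cases "x = \<one>")
  case True
  then show ?thesis using two_is_prime_nat by (metis nat_pow_one)
next
  case False
  then have "ord x \<noteq> 1" using ord_eq_1 x by blast
  then obtain s where s: "Factorial_Ring.prime s" "s dvd ord x"
    using prime_factor_nat by blast
  let ?y = "x [^] s"
  have y: "?y \<in> carrier G" "?y \<in> generate G {x}"
    using x nat_pow_in_generate by auto
  have nx: "x \<notin> generate G {?y}"
  proof
    assume "x \<in> generate G {?y}"
    then obtain k :: int where "x = ?y [^] k"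
      using generate_singletonE[OF y(1)] by blast
    then have "x [^] (1::int) = x [^] (int s * k)"
      using x by (simp add: int_pow_pow flip: int_pow_int)
    then have "int (ord x) dvd 1 - int s * k"
      using int_pow_eq[OF x] by (metis cong_iff_dvd_diff cong_sym dvd_minus_iff minus_diff_eq)
    then have "int s dvd 1"
      using s(2) by (meson dvd_trans dvd_triv_left int_dvd_int_iff dvd_diff_right_iff dvd_minus_iff zdvd_zdiffD)
    then show False using s(1) by auto
  qed
  have "?y = \<one>"
  proof (rule ccontr)
    assume "?y \<noteq> \<one>"
    then have "strict_chain G (([] @ [?y]) @ [x])"
      using x y nx generate_empty by (simp only: strict_chain_snoc) simp
    then have "length [?y, x] \<le> length [x]"
      using x y by (intro uniformly_generated_chain_bound[OF fin ug]) (auto intro: generate.incl)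
    then show False by simp
  qed
  then show ?thesis using s by blast
qed

text \<open>
  A third element outside \<open>\<langle>a, b\<rangle>\<close> would continue the chain beyond the two steps that
  \<open>\<langle>x, y\<rangle>\<close> admits.
\<close>

lemma (in group) uniformly_generated_two_generated:
  assumes fin: "finite (carrier G)" and ug: "uniformly_generated G"
    and xy: "x \<in> carrier G" "y \<in> carrier G"
    and ab: "a \<in> generate G {x, y}" "a \<noteq> \<one>" "b \<in> generate G {x, y}" "b \<notin> generate G {a}"
  shows "generate G {a, b} = generate G {x, y}"
proof -
  have sub: "subgroup (generate G {x, y}) G" using xy by (intro generate_is_subgroup) auto
  have abc: "a \<in> carrier G" "b \<in> carrier G"
    using ab subgroup.subset[OF sub] by auto
  have "c \<in> generate G {a, b}" if c: "c \<in> generate G {x, y}" for c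
  proof (rule ccontr)
    assume nc: "c \<notin> generate G {a, b}"
    have "c \<in> carrier G" using c subgroup.subset[OF sub] by auto
    then have "strict_chain G ((([] @ [a]) @ [b]) @ [c])"
      using ab abc nc generate_empty by (simp only: strict_chain_snoc) (simp add: insert_commute)
    then have "length [a, b, c] \<le> length [x, y]"
      using xy ab c by (intro uniformly_generated_chain_bound[OF fin ug]) auto
    then show False by simp
  qed
  moreover have "generate G {a, b} \<subseteq> generate G {x, y}"
    using ab by (intro generate_subgroup_incl sub) auto
  ultimately show ?thesis by blast
qed

section \<open>Groups all of whose chains have length at most two\<close>

text \<open>
  Counting the pairs \<open>(g, x)\<close> by their value \<open>g x g\<inverse>\<close>: as \<open>P\<close> has prime order and is its own
  normalizer, two pairs have the same value exactly when they differ by \<open>g \<mapsto> g u\<close> with \<open>u\<close> in \<open>P\<close>, so all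
  fibres have \<open>card P\<close> elements.
\<close>

lemma (in group) card_conjugates_of_self_normalizing:
  fixes r :: nat
  assumes fin: "finite (carrier G)" and a: "a \<in> carrier G"
    and r: "Factorial_Ring.prime r" "a [^] r = \<one>"
    and self: "\<And>g. g \<in> carrier G \<Longrightarrow> g \<otimes> a \<otimes> inv g \<in> generate G {a} \<Longrightarrow> g \<in> generate G {a}"
  defines "P \<equiv> generate G {a}"
  shows "card ((\<lambda>(g, x). g \<otimes> x \<otimes> inv g) ` (carrier G \<times> (P - {\<one>}))) * card P
           = card (carrier G) * (card P - 1)"
proof -
  let ?D = "carrier G \<times> (P - {\<one>})"
  let ?f = "\<lambda>(g, x). g \<otimes> x \<otimes> inv g"
  have sP: "subgroup P G" unfolding P_def using a by (intro generate_is_subgroup) auto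
  have Pc: "P \<subseteq> carrier G" using subgroup.subset[OF sP] .
  have finP: "finite P" using Pc fin finite_subset by blast
  have comm: "u \<otimes> x = x \<otimes> u" if "u \<in> P" "x \<in> P" for u x
    using that a unfolding P_def
    by (metis generate_singletonE int_pow_mult add.commute)
  have fibre: "card {d \<in> ?D. ?f d = y} = card P" if y: "y \<in> ?f ` ?D" for y
  proof -
    obtain g x where g: "g \<in> carrier G" and x: "x \<in> P" "x \<noteq> \<one>" and yx: "y = g \<otimes> x \<otimes> inv g"
      using y by auto
    have xc: "x \<in> carrier G" using x Pc by blast
    have "{d \<in> ?D. ?f d = y} = (\<lambda>u. (g \<otimes> u, x)) ` P" (is "?L = ?R")
    proof (intro equalityI subsetI)
      fix d assume "d \<in> ?L"
      obtain h z where d: "d = (h, z)" by (cases d)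
      then have h: "h \<in> carrier G" and z: "z \<in> P" "z \<noteq> \<one>"
        and eq: "g \<otimes> x \<otimes> inv g = h \<otimes> z \<otimes> inv h" using \<open>d \<in> ?L\<close> yx by auto
      have zc: "z \<in> carrier G" using z Pc by blast
      let ?u = "inv g \<otimes> h"
      have u: "?u \<in> carrier G" using g h by simp
      have xu: "x = ?u \<otimes> z \<otimes> inv ?u" using conj_eqD[OF g h xc zc eq] .
      have Pz: "generate G {z} = P"
        using prime_cyclic_generate_eq[OF a r] z P_def by blast
      have "a \<in> generate G {z}" using Pz P_def by (simp add: generate.incl)
      then obtain k :: int where k: "a = z [^] k" using generate_singletonE[OF zc] by blast
      \<comment> \<open>\<open>?u\<close> moves the generator \<open>z\<close> of \<open>P\<close> into \<open>P\<close>, hence normalizes \<open>P\<close>.\<close>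
      have "?u \<otimes> a \<otimes> inv ?u = x [^] k"
        unfolding k using conj_int_pow[OF u zc, of k] xu by simp
      also have "\<dots> \<in> P" using subgroup_int_pow_closed[OF sP x(1)] .
      finally have uP: "?u \<in> P" using self[OF u] P_def by simp
      then have "x = z"
        using xu comm[OF uP z(1)] u zc by (simp add: m_assoc)
      moreover have "h = g \<otimes> ?u" using g h by (simp add: m_assoc[symmetric])
      ultimately show "d \<in> ?R" using d uP by blast
    next
      fix d assume "d \<in> ?R"
      then obtain u where d: "d = (g \<otimes> u, x)" and u: "u \<in> P" by blast
      have uc: "u \<in> carrier G" using u Pc by blast
      have "(g \<otimes> u) \<otimes> x \<otimes> inv (g \<otimes> u) = g \<otimes> ((u \<otimes> x) \<otimes> inv u) \<otimes> inv g"
        using g uc xc by (simp add: inv_mult_group m_assoc)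
      also have "(u \<otimes> x) \<otimes> inv u = x"
        using comm[OF u x(1)] uc xc by (simp add: m_assoc)
      finally show "d \<in> ?L" using d g uc x yx by simp
    qed
    moreover have "inj_on (\<lambda>u. (g \<otimes> u, x)) P"
      using g Pc by (intro inj_onI) (metis l_cancel subsetD prod.inject)
    ultimately show ?thesis by (simp add: card_image)
  qed
  have "card ?D = (\<Sum>y\<in>?f ` ?D. card {d \<in> ?D. ?f d = y})"
    using sum.image_gen[of ?D "\<lambda>_. 1::nat" ?f] fin finP by simp
  also have "\<dots> = card (?f ` ?D) * card P"
    using fibre by simp
  finally show ?thesis
    using finP subgroup.one_closed[OF sP] by (simp add: card_cartesian_product)
qed

text \<open>
  If no \<open>\<langle>a\<rangle>\<close> is normal, each is maximal and hence its own normalizer, so the nontrivial elements of its conjugates make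
  up the fraction \<open>1 - 1 / card \<langle>a\<rangle>\<close> of the group, which is at least one half. This leaves some
  \<open>b \<noteq> \<one>\<close> outside, and the conjugates of \<open>\<langle>b\<rangle>\<close> make up another half, disjoint from the first. The two
  halves leave no room for the neutral element.
\<close>

lemma (in group) length_two_imp_normal_cyclic:
  assumes fin: "finite (carrier G)" and nontriv: "carrier G \<noteq> {\<one>}"
    and prm: "\<And>x. x \<in> carrier G \<Longrightarrow> \<exists>r::nat. Factorial_Ring.prime r \<and> x [^] r = \<one>"
    and max: "\<And>a b. \<lbrakk>a \<in> carrier G; a \<noteq> \<one>; b \<in> carrier G; b \<notin> generate G {a}\<rbrakk>
                \<Longrightarrow> generate G {a, b} = carrier G"
  shows "\<exists>n \<in> carrier G. n \<noteq> \<one> \<and> (\<forall>g \<in> carrier G. g \<otimes> n \<otimes> inv g \<in> generate G {n})"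
proof (rule ccontr)
  assume "\<not> ?thesis"
  then have nn: "\<And>n. n \<in> carrier G \<Longrightarrow> n \<noteq> \<one> \<Longrightarrow> \<exists>g \<in> carrier G. g \<otimes> n \<otimes> inv g \<notin> generate G {n}"
    by blast
  define C where "C a = (\<lambda>(g, x). g \<otimes> x \<otimes> inv g) ` (carrier G \<times> (generate G {a} - {\<one>}))" for a
  have self: "g \<in> generate G {a}"
    if a: "a \<in> carrier G" "a \<noteq> \<one>" and g: "g \<in> carrier G" "g \<otimes> a \<otimes> inv g \<in> generate G {a}" for a g
  proof (rule ccontr)
    assume "g \<notin> generate G {a}"
    then have eq: "generate G {a, g} = carrier G" using max a g by blast
    obtain r :: nat where r: "Factorial_Ring.prime r" "a [^] r = \<one>" using prm a by blast
    have "generate G {a, g} \<subseteq> {h \<in> carrier G. h \<otimes> a \<otimes> inv h \<in> generate G {a}}"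
      using a g by (intro generate_subgroup_incl normalizer_of_prime_cyclic_subgroup[OF a(1) r])
        (auto simp: m_assoc generate.incl)
    then show False using eq nn[OF a] by blast
  qed
  have gc: "generate G {a} \<subseteq> carrier G" if "a \<in> carrier G" for a
    using that generate_incl by simp
  have cardC: "card (C a) * card (generate G {a}) = card (carrier G) * (card (generate G {a}) - 1)"
    if a: "a \<in> carrier G" "a \<noteq> \<one>" for a
    using prm[OF a(1)] card_conjugates_of_self_normalizing[OF fin a(1)] self[OF a]
    unfolding C_def by blast
  have two: "2 \<le> card (generate G {a})" if a: "a \<in> carrier G" "a \<noteq> \<one>" for a
  proof -
    have "card {\<one>, a} \<le> card (generate G {a})"
      using a fin finite_subset[OF gc] by (intro card_mono) (auto intro: generate.incl generate.one)
    then show ?thesis using a by simp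
  qed
  \<comment> \<open>Since \<open>2 * (c - 1) \<ge> c\<close> for \<open>c \<ge> 2\<close>.\<close>
  have half: "card (carrier G) \<le> 2 * card (C a)" if a: "a \<in> carrier G" "a \<noteq> \<one>" for a
  proof -
    have "card (carrier G) * card (generate G {a}) \<le> card (carrier G) * (2 * (card (generate G {a}) - 1))"
      using two[OF a] by (intro mult_le_mono2) linarith
    also have "\<dots> = 2 * card (C a) * card (generate G {a})"
      using cardC[OF a] by simp
    finally show ?thesis using two[OF a] by simp
  qed
  have Csub: "C a \<subseteq> carrier G - {\<one>}" if a: "a \<in> carrier G" for a
  proof
    fix y assume "y \<in> C a"
    then obtain g x where gx: "g \<in> carrier G" "x \<in> carrier G" "x \<noteq> \<one>" "y = g \<otimes> x \<otimes> inv g"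
      using gc[OF a] by (auto simp: C_def)
    moreover have "y \<noteq> \<one>"
    proof
      assume "y = \<one>"
      then have "g \<otimes> x \<otimes> inv g = g \<otimes> \<one> \<otimes> inv g" using gx by simp
      then show False using gx by (metis inv_closed l_cancel m_closed one_closed r_cancel)
    qed
    ultimately show "y \<in> carrier G - {\<one>}" by simp
  qed
  obtain a where a: "a \<in> carrier G" "a \<noteq> \<one>" using nontriv by blast
  have "generate G {a} \<noteq> carrier G" using nn[OF a] a by auto
  then have lt: "card (generate G {a}) < card (carrier G)"
    using gc[OF a(1)] fin by (simp add: psubset_card_mono psubsetI)
  \<comment> \<open>The conjugates of a proper subgroup do not cover the group: equality would force
    \<open>card \<langle>a\<rangle> = card G\<close> in the count above.\<close>
  have "C a \<noteq> carrier G - {\<one>}"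
  proof
    assume "C a = carrier G - {\<one>}"
    then have "(card (carrier G) - 1) * card (generate G {a})
        = card (carrier G) * (card (generate G {a}) - 1)"
      using cardC[OF a] fin by simp
    moreover obtain c where c: "card (generate G {a}) = Suc c" using two[OF a] by (cases "card (generate G {a})") auto
    moreover obtain n where "card (carrier G) = Suc n" using lt by (cases "card (carrier G)") auto
    ultimately show False using lt by simp
  qed
  then obtain b where b: "b \<in> carrier G" "b \<noteq> \<one>" "b \<notin> C a" using Csub[OF a(1)] by blast
  have "C a \<inter> C b = {}"
  proof (rule ccontr)
    assume "C a \<inter> C b \<noteq> {}"
    then obtain y where y: "y \<in> C a" "y \<in> C b" by blast
    obtain g x where g: "g \<in> carrier G" and x: "x \<in> generate G {a}" "x \<noteq> \<one>"
      and yx: "y = g \<otimes> x \<otimes> inv g" using y(1) by (auto simp: C_def)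
    obtain h z where h: "h \<in> carrier G" and z: "z \<in> generate G {b}" "z \<noteq> \<one>"
      and yz: "y = h \<otimes> z \<otimes> inv h" using y(2) by (auto simp: C_def)
    have eq: "h \<otimes> z \<otimes> inv h = g \<otimes> x \<otimes> inv g" using yx yz by simp
    have xc: "x \<in> carrier G" and zc: "z \<in> carrier G" using x z gc a b by blast+
    let ?u = "inv h \<otimes> g"
    have u: "?u \<in> carrier G" using g h by simp
    have zu: "z = ?u \<otimes> x \<otimes> inv ?u" using conj_eqD[OF h g zc xc eq] .
    obtain s :: nat where s: "Factorial_Ring.prime s" "b [^] s = \<one>" using prm b by blast
    have "b \<in> generate G {z}"
      using prime_cyclic_generate_eq[OF b(1) s z] by (simp add: generate.incl)
    then obtain k :: int where k: "b = z [^] k" using generate_singletonE[OF zc] by blast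
    have bu: "b = ?u \<otimes> x [^] k \<otimes> inv ?u"
      unfolding k using conj_int_pow[OF u xc, of k] zu by simp
    have "x [^] k \<noteq> \<one>" using bu b(2) u by auto
    moreover have "x [^] k \<in> generate G {a}"
      using subgroup_int_pow_closed[OF generate_is_subgroup x(1)] a by simp
    ultimately have "b \<in> C a" unfolding C_def using bu u by (intro image_eqI[of _ _ "(?u, x [^] k)"]) auto
    then show False using b by blast
  qed
  then have "card (C a) + card (C b) = card (C a \<union> C b)"
    using Csub a b fin finite_subset[of _ "carrier G"] by (intro card_Un_disjoint[symmetric]) blast+
  also have "\<dots> \<le> card (carrier G - {\<one>})"
    using Csub a b fin by (intro card_mono) auto
  also have "\<dots> < card (carrier G)" using fin by (intro psubset_card_mono) auto
  finally show False using half[OF a] half[OF b(1,2)] by linarith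
qed

section \<open>The scalar kernel of a uniformly generated group\<close>

lemma (in group) uniformly_generated_two_generated_normal_cyclic:
  assumes fin: "finite (carrier G)" and ug: "uniformly_generated G"
    and xy: "x \<in> carrier G" "y \<in> carrier G" and nt: "generate G {x, y} \<noteq> {\<one>}"
  shows "\<exists>n \<in> generate G {x, y}. n \<noteq> \<one> \<and>
           (\<forall>g \<in> generate G {x, y}. g \<otimes> n \<otimes> inv g \<in> generate G {n})"
proof -
  let ?H = "generate G {x, y}"
  let ?K = "G\<lparr>carrier := ?H\<rparr>"
  have sub: "subgroup ?H G" using xy by (intro generate_is_subgroup) auto
  have Hc: "?H \<subseteq> carrier G" using subgroup.subset[OF sub] .
  interpret K: group ?K using subgroup.subgroup_is_group[OF sub is_group] .
  have gen: "generate ?K S = generate G S" if "S \<subseteq> ?H" for S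
    using generate_consistent[OF that sub] by simp
  have "\<exists>n \<in> carrier ?K. n \<noteq> \<one>\<^bsub>?K\<^esub> \<and>
      (\<forall>g \<in> carrier ?K. g \<otimes>\<^bsub>?K\<^esub> n \<otimes>\<^bsub>?K\<^esub> inv\<^bsub>?K\<^esub> g \<in> generate ?K {n})"
  proof (rule K.length_two_imp_normal_cyclic)
    show "finite (carrier ?K)" using fin Hc finite_subset by auto
    show "carrier ?K \<noteq> {\<one>\<^bsub>?K\<^esub>}" using nt by simp
    show "\<exists>r::nat. Factorial_Ring.prime r \<and> z [^]\<^bsub>?K\<^esub> r = \<one>\<^bsub>?K\<^esub>" if "z \<in> carrier ?K" for z
      using uniformly_generated_prime_exponent[OF fin ug, of z] that Hc
      by (auto simp: nat_pow_consistent[symmetric])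
    show "generate ?K {a, b} = carrier ?K"
      if "a \<in> carrier ?K" "a \<noteq> \<one>\<^bsub>?K\<^esub>" "b \<in> carrier ?K" "b \<notin> generate ?K {a}" for a b
      using that uniformly_generated_two_generated[OF fin ug xy, of a b] by (simp add: gen)
  qed
  then show ?thesis
    by (simp add: gen m_inv_consistent[OF sub])
qed

text \<open>
  Conjugation by \<open>x\<close> raises \<open>n\<close> to some power \<open>k\<close>, and \<open>k\<^sup>p = 1\<close> modulo \<open>r\<close>. The multiplicative order of \<open>k\<close>
  divides the prime \<open>p\<close> as well as \<open>r - 1 < p\<close>, so it is \<open>1\<close>.
\<close>

lemma (in group) large_prime_conj_imp_commute:
  fixes p r :: nat
  assumes fin: "finite (carrier G)" and x: "x \<in> carrier G" and n: "n \<in> carrier G"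
    and p: "Factorial_Ring.prime p" "x [^] p = \<one>"
    and r: "Factorial_Ring.prime r" "n [^] r = \<one>" "r \<le> p"
    and xn: "x \<otimes> n \<otimes> inv x \<in> generate G {n}"
  shows "x \<otimes> n = n \<otimes> x"
proof (cases "n = \<one>")
  case False
  obtain k :: nat where k: "x \<otimes> n \<otimes> inv x = n [^] k"
    using generate_singleton_nat[OF fin n xn] by blast
  have ordn: "ord n = r"
    using False n r by (metis pow_eq_id ord_eq_1 prime_nat_iff)
  have "x \<otimes> n = n [^] int k \<otimes> x"
    using k x n inv_solve_right' by (metis int_pow_int nat_pow_closed m_closed)
  then have "x [^] p \<otimes> n = n [^] (int k ^ p) \<otimes> x [^] p"
    by (rule commutation_pow_left[OF x n])
  then have n_fix: "n [^] (k ^ p) = n [^] (1::nat)"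
    using p n by (simp add: int_pow_int flip: of_nat_power)
  have peq: "[i = j] (mod r)" if "n [^] i = n [^] j" for i j :: nat
    using int_pow_eq[OF n, of "int i" "int j"] that ordn
    by (metis cong_iff_dvd_diff cong_int_iff cong_sym int_pow_int)
  have kp: "[k ^ p = 1] (mod r)" by (rule peq[OF n_fix])
  have "p > 0" "r > 1" using p(1) r(1) prime_gt_0_nat prime_gt_1_nat by blast+
  have "\<not> r dvd k"
  proof
    assume "r dvd k"
    then have "r dvd k ^ p" using \<open>p > 0\<close> by (simp add: dvd_power_same dvd_trans[OF _ dvd_power])
    then have "r dvd 1" using kp by (metis cong_dvd_iff)
    then show False using \<open>r > 1\<close> by simp
  qed
  then have "[k ^ (r - 1) = 1] (mod r)"
    using fermat_theorem[OF r(1)] by blast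
  then have d: "Pocklington.ord r k dvd r - 1" "Pocklington.ord r k dvd p"
    using kp ord_divides by blast+
  have "Pocklington.ord r k \<noteq> p"
    using d(1) r(3) \<open>r > 1\<close> by (auto dest: dvd_imp_le)
  then have "Pocklington.ord r k = 1"
    using d(2) p(1) prime_nat_iff by blast
  then have "[k = 1] (mod r)"
    using ord_divides[of k 1 r] by simp
  then have "int r dvd 1 - int k"
    by (metis cong_iff_dvd_diff cong_int_iff cong_sym of_nat_1)
  then have "n [^] int k = n [^] (1::int)"
    using int_pow_eq[OF n] ordn by (metis dvd_minus_iff minus_diff_eq)
  then have "x \<otimes> n \<otimes> inv x = n"
    using k n by (simp add: int_pow_int)
  then show ?thesis
    using x n by (metis inv_solve_right m_closed)
qed (use x in simp)

text \<open>
  Let \<open>\<langle>n\<rangle>\<close> be a normal subgroup of \<open>\<langle>x, y\<rangle>\<close>. Either it is \<open>\<langle>x\<rangle>\<close>, or \<open>n\<close> and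
  \<open>x\<close> generate \<open>\<langle>x, y\<rangle>\<close>; in the second case the maximality of \<open>p\<close> forces \<open>x\<close> to commute with \<open>n\<close>, so
  that \<open>\<langle>x, y\<rangle>\<close> is abelian.
\<close>

lemma (in group) maximal_order_cyclic_normal:
  fixes p :: nat
  assumes fin: "finite (carrier G)" and ug: "uniformly_generated G"
    and p: "Factorial_Ring.prime p"
    and pmax: "\<And>r z. \<lbrakk>Factorial_Ring.prime (r::nat); z \<in> carrier G; z \<noteq> \<one>; z [^] r = \<one>\<rbrakk> \<Longrightarrow> r \<le> p"
    and x: "x \<in> carrier G" "x [^] p = \<one>" and y: "y \<in> carrier G"
  shows "y \<otimes> x \<otimes> inv y \<in> generate G {x}"
proof (cases "x = \<one>")
  case True
  then show ?thesis using y by (simp add: generate.one)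
next
  case False
  let ?H = "generate G {x, y}"
  have sub: "subgroup ?H G" using x y by (intro generate_is_subgroup) auto
  have xyH: "x \<in> ?H" "y \<in> ?H" by (auto intro: generate.incl)
  then have "?H \<noteq> {\<one>}" using False by blast
  then obtain n where n: "n \<in> ?H" "n \<noteq> \<one>" and nn: "\<And>g. g \<in> ?H \<Longrightarrow> g \<otimes> n \<otimes> inv g \<in> generate G {n}"
    using uniformly_generated_two_generated_normal_cyclic[OF fin ug x(1) y] by blast
  have nc: "n \<in> carrier G" using n subgroup.subset[OF sub] by blast
  obtain r :: nat where r: "Factorial_Ring.prime r" "n [^] r = \<one>"
    using uniformly_generated_prime_exponent[OF fin ug nc] by blast
  show ?thesis
  proof (cases "x \<in> generate G {n}")
    case True
    then have eq: "generate G {x} = generate G {n}"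
      using prime_cyclic_generate_eq[OF nc r True False] by simp
    obtain k :: int where k: "x = n [^] k" using generate_singletonE[OF nc True] by blast
    have "y \<otimes> x \<otimes> inv y = (y \<otimes> n \<otimes> inv y) [^] k"
      using conj_int_pow[OF y nc] k by simp
    also have "\<dots> \<in> generate G {n}"
      using subgroup_int_pow_closed[OF generate_is_subgroup nn[OF xyH(2)]] nc by simp
    finally show ?thesis using eq by simp
  next
    case xn: False
    have comm: "x \<otimes> n = n \<otimes> x"
      using large_prime_conj_imp_commute[OF fin x(1) nc p x(2) r pmax[OF r(1) nc n(2) r(2)] nn[OF xyH(1)]] .
    have "generate G {n, x} = ?H"
      using uniformly_generated_two_generated[OF fin ug x(1) y n xyH(1) xn] .
    then have "y \<in> generate G {n, x}" using xyH by simp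
    moreover have "generate G {n, x} \<subseteq> {h \<in> carrier G. h \<otimes> x \<otimes> inv h \<in> generate G {x}}"
      using x nc comm by (intro generate_subgroup_incl normalizer_of_prime_cyclic_subgroup[OF x(1) p x(2)])
        (auto simp: m_assoc generate.incl comm[symmetric])
    ultimately show ?thesis by blast
  qed
qed

text \<open>
  In the two families of the classification, \<open>N\<close> can be taken to be the whole group or the elementary abelian
  normal factor. The third condition says that every cyclic subgroup of \<open>N\<close> is normal in \<open>G\<close>, so that \<open>G\<close> acts on \<open>N\<close> by
  power maps; the fourth one says that \<open>G\<close> modulo \<open>N\<close> has no proper nontrivial subgroup. The conditions are
  equations between elements, which isomorphisms transport directly.
\<close>

definition scalar_kernel :: "('a, 'b) monoid_scheme \<Rightarrow> 'a set \<Rightarrow> bool" where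
  "scalar_kernel G N \<longleftrightarrow> subgroup N G \<and>
     (\<forall>x \<in> carrier G. \<exists>r::nat. Factorial_Ring.prime r \<and> x [^]\<^bsub>G\<^esub> r = \<one>\<^bsub>G\<^esub>) \<and>
     (\<forall>x \<in> N. \<forall>g \<in> carrier G. \<exists>k::int. g \<otimes>\<^bsub>G\<^esub> x = x [^]\<^bsub>G\<^esub> k \<otimes>\<^bsub>G\<^esub> g) \<and>
     (\<forall>x \<in> carrier G - N. \<forall>z \<in> carrier G - N. \<exists>n \<in> N. \<exists>j::nat. x = n \<otimes>\<^bsub>G\<^esub> z [^]\<^bsub>G\<^esub> j)"

lemma scalar_kernelD:
  assumes "scalar_kernel G N"
  shows "subgroup N G"
    and "x \<in> carrier G \<Longrightarrow> \<exists>r::nat. Factorial_Ring.prime r \<and> x [^]\<^bsub>G\<^esub> r = \<one>\<^bsub>G\<^esub>"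
    and "x \<in> N \<Longrightarrow> g \<in> carrier G \<Longrightarrow> \<exists>k::int. g \<otimes>\<^bsub>G\<^esub> x = x [^]\<^bsub>G\<^esub> k \<otimes>\<^bsub>G\<^esub> g"
    and "\<lbrakk>x \<in> carrier G; x \<notin> N; z \<in> carrier G; z \<notin> N\<rbrakk>
           \<Longrightarrow> \<exists>n \<in> N. \<exists>j::nat. x = n \<otimes>\<^bsub>G\<^esub> z [^]\<^bsub>G\<^esub> j"
    and "x \<in> N \<Longrightarrow> x \<in> carrier G"
  using assms subgroup.subset[of N G] unfolding scalar_kernel_def by auto

lemma (in group) scalar_kernel_commute:
  assumes sk: "scalar_kernel G N" and x: "x \<in> N" and y: "y \<in> N"
  shows "x \<otimes> y = y \<otimes> x"
proof -
  have conj: "h \<otimes> z \<otimes> inv h \<in> generate G {z}" if z: "z \<in> N" and h: "h \<in> N" for z h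
  proof -
    note zc = scalar_kernelD(5)[OF sk z] and hc = scalar_kernelD(5)[OF sk h]
    obtain k :: int where "h \<otimes> z = z [^] k \<otimes> h"
      using scalar_kernelD(3)[OF sk z hc] by blast
    then have "h \<otimes> z \<otimes> inv h = z [^] k" using zc hc by (simp add: m_assoc)
    then show ?thesis using int_pow_in_generate[OF zc] by simp
  qed
  note xc = scalar_kernelD(5)[OF sk x] and yc = scalar_kernelD(5)[OF sk y]
  obtain r :: nat where r: "Factorial_Ring.prime r" "x [^] r = \<one>"
    using scalar_kernelD(2)[OF sk xc] by blast
  obtain s :: nat where s: "Factorial_Ring.prime s" "y [^] s = \<one>"
    using scalar_kernelD(2)[OF sk yc] by blast
  show ?thesis
    by (rule normal_prime_cyclic_commute[OF xc yc r s conj[OF y x] conj[OF x y]])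
qed

text \<open>
  The kernel consists of the elements of exponent \<open>p\<close>, for the largest prime \<open>p\<close> that occurs. An element that
  commutes with a nontrivial element of \<open>N\<close> lies in \<open>N\<close>; as power maps commute, this applies to every commutator of \<open>G\<close>.
  For \<open>y\<close> and \<open>z\<close> outside \<open>N\<close> with nontrivial commutator \<open>w\<close> this gives \<open>\<langle>y, z\<rangle> = \<langle>w, z\<rangle>\<close>, which is contained in
  \<open>N \<langle>z\<rangle>\<close>.
\<close>

lemma (in group) uniformly_generated_imp_scalar_kernel:
  assumes fin: "finite (carrier G)" and ug: "uniformly_generated G"
  shows "\<exists>N. scalar_kernel G N"
proof (cases "carrier G = {\<one>}")
  case True
  have "scalar_kernel G (carrier G)"
    unfolding scalar_kernel_def
    using True subgroup_self uniformly_generated_prime_exponent[OF fin ug] by auto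
  then show ?thesis by blast
next
  case False
  note prm = uniformly_generated_prime_exponent[OF fin ug]
  define R where "R = {r::nat. Factorial_Ring.prime r \<and> (\<exists>z \<in> carrier G. z \<noteq> \<one> \<and> z [^] r = \<one>)}"
  obtain x1 where "x1 \<in> carrier G" "x1 \<noteq> \<one>" using False by blast
  then have Rne: "R \<noteq> {}" using prm unfolding R_def by blast
  have "R \<subseteq> {..order G}"
  proof
    fix r assume "r \<in> R"
    then obtain z where z: "Factorial_Ring.prime r" "z \<in> carrier G" "z \<noteq> \<one>" "z [^] r = \<one>"
      unfolding R_def by blast
    then have "ord z = r" by (metis pow_eq_id ord_eq_1 prime_nat_iff)
    then show "r \<in> {..order G}" using ord_le_group_order[OF fin z(2)] by simp
  qed
  then have Rfin: "finite R" using finite_subset by blast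
  define p where "p = Max R"
  have "p \<in> R" using Rfin Rne p_def by simp
  then obtain x0 where p: "Factorial_Ring.prime p" and x0: "x0 \<in> carrier G" "x0 \<noteq> \<one>" "x0 [^] p = \<one>"
    unfolding R_def by blast
  have pmax: "r \<le> p" if "Factorial_Ring.prime r" "z \<in> carrier G" "z \<noteq> \<one>" "z [^] r = \<one>" for r z
    using that Rfin unfolding p_def R_def by (intro Max_ge) auto
  define N where "N = {x \<in> carrier G. x [^] p = \<one>}"
  have norm: "y \<otimes> x \<otimes> inv y \<in> generate G {x}" if "x \<in> N" "y \<in> carrier G" for x y
  proof (rule maximal_order_cyclic_normal[OF fin ug p])
    show "r \<le> p" if "Factorial_Ring.prime r" "z \<in> carrier G" "z \<noteq> \<one>" "z [^] r = \<one>" for r z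
      using pmax that .
  qed (use that in \<open>auto simp: N_def\<close>)
  have subN: "subgroup N G"
  proof (rule subgroupI)
    show "N \<subseteq> carrier G" unfolding N_def by blast
    show "N \<noteq> {}" using x0 unfolding N_def by blast
    show "inv x \<in> N" if "x \<in> N" for x
      using that unfolding N_def by (simp add: nat_pow_inv)
    show "x \<otimes> y \<in> N" if "x \<in> N" "y \<in> N" for x y
    proof -
      have "x \<otimes> y = y \<otimes> x"
        using normal_prime_cyclic_commute[of x y p p] that norm p unfolding N_def by blast
      then show ?thesis
        using that pow_mult_distrib[of x y p] unfolding N_def by simp
    qed
  qed
  have scal: "\<exists>k::int. g \<otimes> x = x [^] k \<otimes> g" if x: "x \<in> N" and g: "g \<in> carrier G" for x g
  proof -
    have xc: "x \<in> carrier G" using x unfolding N_def by blast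
    obtain k :: int where k: "g \<otimes> x \<otimes> inv g = x [^] k"
      using generate_singletonE[OF xc norm[OF x g]] by blast
    have "g \<otimes> x = (g \<otimes> x \<otimes> inv g) \<otimes> g" using g xc by (simp add: m_assoc)
    then show ?thesis using k by metis
  qed
  have normalN: "N \<lhd> G" using normal_if_conj_powers[OF subN scal] .
  have x0N: "x0 \<in> N" using x0 unfolding N_def by blast
  have cent: "g \<in> N" if "g \<in> carrier G" "t \<in> N" "t \<noteq> \<one>" "t \<otimes> g = g \<otimes> t" for g t
    using commuting_same_prime_exponent[OF prm, of t p g] that p unfolding N_def by blast
  have noncomm: "\<exists>n \<in> N. \<exists>j::nat. y = n \<otimes> z [^] j"
    if y: "y \<in> carrier G" "y \<notin> N" and z: "z \<in> carrier G" "z \<notin> N" and yz: "y \<otimes> z \<noteq> z \<otimes> y" for y z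
  proof -
    define w where "w = (y \<otimes> z) \<otimes> inv (z \<otimes> y)"
    have wc: "w \<in> carrier G" using y z w_def by simp
    obtain k l :: int where k: "y \<otimes> x0 = x0 [^] k \<otimes> y" and l: "z \<otimes> x0 = x0 [^] l \<otimes> z"
      using scal[OF x0N] y z by metis
    have pw: "y \<otimes> x0 [^] i = x0 [^] (k * i) \<otimes> y" "z \<otimes> x0 [^] i = x0 [^] (l * i) \<otimes> z" for i :: int
      using commutation_pow_right k l y z x0 by blast+
    \<comment> \<open>Both \<open>y \<otimes> z\<close> and \<open>z \<otimes> y\<close> conjugate \<open>x0\<close> to \<open>t\<close>, so their quotient \<open>w\<close> commutes with \<open>t\<close>.\<close>
    define t where "t = x0 [^] (k * l)"
    have tN: "t \<in> N" unfolding t_def using subgroup_int_pow_closed[OF subN x0N] .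
    have tc: "t \<in> carrier G" using x0 t_def by simp
    have "(y \<otimes> z) \<otimes> x0 = y \<otimes> (z \<otimes> x0)" using y z x0 by (simp add: m_assoc)
    also have "\<dots> = (y \<otimes> x0 [^] l) \<otimes> z" using l y z x0 by (simp add: m_assoc)
    also have "\<dots> = t \<otimes> (y \<otimes> z)" using pw(1)[of l] y z x0 by (simp add: m_assoc t_def)
    finally have a: "(y \<otimes> z) \<otimes> x0 = t \<otimes> (y \<otimes> z)" .
    have "(z \<otimes> y) \<otimes> x0 = z \<otimes> (y \<otimes> x0)" using y z x0 by (simp add: m_assoc)
    also have "\<dots> = (z \<otimes> x0 [^] k) \<otimes> y" using k y z x0 by (simp add: m_assoc)
    also have "\<dots> = t \<otimes> (z \<otimes> y)" using pw(2)[of k] y z x0 by (simp add: m_assoc t_def mult.commute)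
    finally have b: "(z \<otimes> y) \<otimes> x0 = t \<otimes> (z \<otimes> y)" .
    define v where "v = z \<otimes> y"
    have vc: "v \<in> carrier G" using y z v_def by simp
    have t: "t = v \<otimes> x0 \<otimes> inv v"
      using b tc vc x0 unfolding v_def[symmetric] by (simp add: m_assoc)
    have w: "w = (y \<otimes> z) \<otimes> inv v" unfolding w_def v_def ..
    have "inv v \<otimes> (v \<otimes> (x0 \<otimes> inv v)) = x0 \<otimes> inv v"
      using vc x0 by (metis inv_closed l_inv l_one m_assoc m_closed)
    then have "w \<otimes> t = (y \<otimes> z) \<otimes> x0 \<otimes> inv (z \<otimes> y)"
      unfolding v_def[symmetric] w t using y z x0 vc by (simp add: m_assoc)
    also have "\<dots> = t \<otimes> w"
      unfolding a w_def using y z tc by (simp add: m_assoc)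
    finally have wt: "t \<otimes> w = w \<otimes> t" by simp
    have "t \<noteq> \<one>"
    proof
      assume "t = \<one>"
      then have "(y \<otimes> z) \<otimes> x0 = (y \<otimes> z) \<otimes> \<one>" using a y z by simp
      then show False using y z x0 by (metis l_cancel m_closed one_closed)
    qed
    then have wN: "w \<in> N" using cent[OF wc tN _ wt] by blast
    have w1: "w \<noteq> \<one>"
      using yz y z unfolding w_def by (metis inv_equality inv_inv inv_closed m_closed)
    have gwN: "generate G {w} \<subseteq> N" using wN by (intro generate_subgroup_incl subN) auto
    have sub: "subgroup (generate G {y, z}) G" using y z by (intro generate_is_subgroup) auto
    have yzH: "y \<in> generate G {y, z}" "z \<in> generate G {y, z}" by (auto intro: generate.incl)
    have "w \<in> generate G {y, z}"
      unfolding w_def using subgroup.m_closed[OF sub] subgroup.m_inv_closed[OF sub] yzH by simp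
    then have "generate G {w, z} = generate G {y, z}"
      using uniformly_generated_two_generated[OF fin ug y(1) z(1) _ w1 yzH(2)] gwN z by blast
    then have "y \<in> generate G {w, z}" using yzH by simp
    moreover have "generate G {w, z} \<subseteq> N <#> generate G {z}"
    proof (rule generate_subgroup_incl)
      have "w = w \<otimes> \<one>" "z = \<one> \<otimes> z" using wc z by simp_all
      then show "{w, z} \<subseteq> N <#> generate G {z}"
        using wN subgroup.one_closed[OF subN] unfolding set_mult_def
        by (auto intro: generate.incl generate.one)
      show "subgroup (N <#> generate G {z}) G"
        using z by (intro mult_norm_subgroup normalN generate_is_subgroup) auto
    qed
    ultimately obtain n u where "n \<in> N" "u \<in> generate G {z}" "y = n \<otimes> u"
      unfolding set_mult_def by blast
    then show ?thesis using generate_singleton_nat[OF fin z(1)] by metis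
  qed
  have "\<exists>n \<in> N. \<exists>j::nat. y = n \<otimes> z [^] j"
    if y: "y \<in> carrier G - N" and z: "z \<in> carrier G - N" for y z
  proof (cases "y \<otimes> z = z \<otimes> y")
    case False
    then show ?thesis using noncomm y z by blast
  next
    case True
    have yc: "y \<in> carrier G" and zc: "z \<in> carrier G" using y z by auto
    \<comment> \<open>Multiplying \<open>y\<close> by an element of \<open>N\<close> does not change the claim and destroys commutation with \<open>z\<close>, which
      does not commute with \<open>x0\<close>.\<close>
    let ?y = "x0 \<otimes> y"
    have eq: "y = inv x0 \<otimes> ?y" using yc x0 by (simp flip: m_assoc)
    have "?y \<notin> N"
    proof
      assume "?y \<in> N"
      then have "inv x0 \<otimes> ?y \<in> N"
        using subgroup.m_closed[OF subN] subgroup.m_inv_closed[OF subN] x0N by blast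
      then show False using eq y by simp
    qed
    moreover have "?y \<otimes> z \<noteq> z \<otimes> ?y"
    proof
      assume a: "?y \<otimes> z = z \<otimes> ?y"
      have "(x0 \<otimes> z) \<otimes> y = x0 \<otimes> (y \<otimes> z)" using True x0 yc zc by (simp add: m_assoc)
      also have "\<dots> = (z \<otimes> x0) \<otimes> y" using a x0 yc zc by (simp add: m_assoc)
      finally have "x0 \<otimes> z = z \<otimes> x0" using x0 yc zc by simp
      then show False using cent[OF zc x0N x0(2)] z by blast
    qed
    ultimately obtain n and j :: nat where n: "n \<in> N" "?y = n \<otimes> z [^] j"
      using noncomm[of ?y z] x0 yc z by auto
    then have "y = (inv x0 \<otimes> n) \<otimes> z [^] j"
      using eq x0 zc subgroup.subset[OF subN] by (metis inv_closed m_assoc nat_pow_closed subsetD)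
    moreover have "inv x0 \<otimes> n \<in> N"
      using subgroup.m_closed[OF subN] subgroup.m_inv_closed[OF subN] x0N n by blast
    ultimately show ?thesis by blast
  qed
  then have "scalar_kernel G N"
    unfolding scalar_kernel_def using subN prm scal by blast
  then show ?thesis by blast
qed

section \<open>Elementary abelian groups\<close>

lemma carrier_cyclic_power: "0 < p \<Longrightarrow> carrier (cyclic_power p n) = {..<n} \<rightarrow>\<^sub>E {0..<int p}"
  by (simp add: cyclic_power_def carrier_integer_mod_group)

lemma mult_cyclic_power:
  "x \<otimes>\<^bsub>cyclic_power p n\<^esub> y = (\<lambda>i\<in>{..<n}. (x i + y i) mod int p)"
  by (simp add: cyclic_power_def)

lemma comm_group_cyclic_power: "comm_group (cyclic_power p n)"
  by (rule group.group_comm_groupI[OF group_cyclic_power]) (simp add: mult_cyclic_power add.commute)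

lemma pow_cyclic_power:
  assumes "v \<in> carrier (cyclic_power p n)"
  shows "v [^]\<^bsub>cyclic_power p n\<^esub> (t::nat) = (\<lambda>i\<in>{..<n}. (int t * v i) mod int p)"
proof (induction t)
  case 0
  then show ?case by (simp add: cyclic_power_def)
next
  case (Suc t)
  then show ?case
    using assms by (auto simp: mult_cyclic_power fun_eq_iff mod_add_left_eq mod_add_right_eq algebra_simps)
qed

lemma pow_exponent_cyclic_power:
  assumes "v \<in> carrier (cyclic_power p n)"
  shows "v [^]\<^bsub>cyclic_power p n\<^esub> p = \<one>\<^bsub>cyclic_power p n\<^esub>"
  unfolding pow_cyclic_power[OF assms] by (simp add: cyclic_power_def)

text \<open>
  Take an embedding of \<open>(C\<^sub>p)\<^sup>n\<close> into \<open>G\<close> with \<open>n\<close> as large as possible. If some \<open>y\<close> is not in its image, then \<open>\<langle>y\<rangle>\<close>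
  meets the image trivially, and sending a new basis vector to \<open>y\<close> extends the embedding to \<open>(C\<^sub>p)\<^sup>n\<^sup>+\<^sup>1\<close>.
\<close>

lemma (in group) elementary_abelian_iso_cyclic_power:
  fixes p :: nat
  assumes fin: "finite (carrier G)" and p: "Factorial_Ring.prime p"
    and comm: "\<And>x y. \<lbrakk>x \<in> carrier G; y \<in> carrier G\<rbrakk> \<Longrightarrow> x \<otimes> y = y \<otimes> x"
    and exp: "\<And>x. x \<in> carrier G \<Longrightarrow> x [^] p = \<one>"
  shows "\<exists>n h. h \<in> iso (cyclic_power p n) G"
proof -
  have p0: "0 < p" using p prime_gt_0_nat by blast
  define Q where "Q n \<longleftrightarrow> (\<exists>h. h \<in> hom (cyclic_power p n) G \<and> inj_on h (carrier (cyclic_power p n)))" for n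
  have "Q 0"
    unfolding Q_def carrier_cyclic_power[OF p0] by (intro exI[of _ "\<lambda>_. \<one>"]) (simp add: hom_def)
  moreover have "n \<le> card (carrier G)" if "Q n" for n
  proof -
    obtain h where h: "h \<in> hom (cyclic_power p n) G" "inj_on h (carrier (cyclic_power p n))"
      using \<open>Q n\<close> unfolding Q_def by blast
    have "p ^ n = card (carrier (cyclic_power p n))"
      unfolding carrier_cyclic_power[OF p0] by (simp add: card_PiE)
    also have "\<dots> \<le> card (carrier G)"
      using h fin by (intro card_inj_on_le[of h] hom_carrier)
    finally have "p ^ n \<le> card (carrier G)" .
    moreover have "2 ^ n \<le> p ^ n" using prime_ge_2_nat[OF p] by (rule power_mono) simp
    ultimately show ?thesis using less_exp[of n] by linarith
  qed
  ultimately have "\<exists>n. Q n \<and> (\<forall>m. Q m \<longrightarrow> m \<le> n)"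
    using Nat.ex_has_greatest_nat[of Q 0 "card (carrier G)"] by simp
  then obtain n where n: "Q n" and nmax: "\<And>m. Q m \<Longrightarrow> m \<le> n" by blast
  let ?C = "cyclic_power p n" and ?D = "cyclic_power p (Suc n)"
  obtain h where h: "h \<in> hom ?C G" "inj_on h (carrier ?C)" using n unfolding Q_def by blast
  interpret h: group_hom ?C G h
    using h group_cyclic_power by (simp add: group_hom_def group_hom_axioms_def is_group)
  have "h ` carrier ?C = carrier G"
  proof (rule ccontr)
    assume "h ` carrier ?C \<noteq> carrier G"
    moreover have "h ` carrier ?C \<subseteq> carrier G" using h.hom_closed by blast
    ultimately obtain y where y: "y \<in> carrier G" "y \<notin> h ` carrier ?C" by blast
    have ymod: "y [^] (a mod int p) = y [^] a" for a :: int
    proof -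
      have "y [^] a = (y [^] int p) [^] (a div int p) \<otimes> y [^] (a mod int p)"
        using y by (simp add: int_pow_pow int_pow_mult[symmetric])
      moreover have "y [^] int p = \<one>" using exp[OF y(1)] by (simp add: int_pow_int)
      ultimately show ?thesis using y by simp
    qed
    define f where "f v = h (restrict v {..<n}) \<otimes> y [^] (v n)" for v
    have res: "restrict v {..<n} \<in> carrier ?C" if "v \<in> carrier ?D" for v
      unfolding carrier_cyclic_power[OF p0] restrict_PiE_iff
      using PiE_mem[OF that[unfolded carrier_cyclic_power[OF p0]]] by simp
    have hc: "h (restrict v {..<n}) \<in> carrier G" if "v \<in> carrier ?D" for v
      using h.hom_closed[OF res[OF that]] .
    have "f \<in> hom ?D G"
    proof (rule homI)
      show "f v \<in> carrier G" if "v \<in> carrier ?D" for v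
        unfolding f_def using hc[OF that] y by simp
      fix v w assume v: "v \<in> carrier ?D" and w: "w \<in> carrier ?D"
      have rvw: "restrict (v \<otimes>\<^bsub>?D\<^esub> w) {..<n} = restrict v {..<n} \<otimes>\<^bsub>?C\<^esub> restrict w {..<n}"
        by (auto simp: mult_cyclic_power fun_eq_iff)
      have "f (v \<otimes>\<^bsub>?D\<^esub> w)
          = h (restrict v {..<n}) \<otimes> h (restrict w {..<n}) \<otimes> (y [^] v n \<otimes> y [^] w n)"
      proof -
        have "(v \<otimes>\<^bsub>?D\<^esub> w) n = (v n + w n) mod int p" by (simp add: mult_cyclic_power)
        then have "y [^] ((v \<otimes>\<^bsub>?D\<^esub> w) n) = y [^] v n \<otimes> y [^] w n"
          using y by (simp only: ymod int_pow_mult)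
        moreover have "h (restrict (v \<otimes>\<^bsub>?D\<^esub> w) {..<n}) = h (restrict v {..<n}) \<otimes> h (restrict w {..<n})"
          using rvw h.hom_mult[OF res[OF v] res[OF w]] by simp
        ultimately show ?thesis unfolding f_def by simp
      qed
      also have "\<dots> = h (restrict v {..<n}) \<otimes> (h (restrict w {..<n}) \<otimes> y [^] v n) \<otimes> y [^] w n"
        using hc[OF v] hc[OF w] y by (simp add: m_assoc)
      also have "h (restrict w {..<n}) \<otimes> y [^] v n = y [^] v n \<otimes> h (restrict w {..<n})"
        using hc[OF w] y by (intro comm) auto
      also have "h (restrict v {..<n}) \<otimes> (y [^] v n \<otimes> h (restrict w {..<n})) \<otimes> y [^] w n = f v \<otimes> f w"
        unfolding f_def using hc[OF v] hc[OF w] y by (simp add: m_assoc)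
      finally show "f (v \<otimes>\<^bsub>?D\<^esub> w) = f v \<otimes> f w" .
    qed
    moreover have "inj_on f (carrier ?D)"
    proof (rule inj_onI)
      fix v w assume v: "v \<in> carrier ?D" and w: "w \<in> carrier ?D" and eq: "f v = f w"
      have lt: "0 \<le> v n" "v n < int p" "0 \<le> w n" "w n < int p"
        using PiE_mem[OF v[unfolded carrier_cyclic_power[OF p0]], of n]
          PiE_mem[OF w[unfolded carrier_cyclic_power[OF p0]], of n] by simp_all
      have "y [^] (w n - v n) = y [^] w n \<otimes> inv (y [^] v n)"
        using int_pow_diff y by simp
      also have "\<dots> = inv (h (restrict w {..<n})) \<otimes> h (restrict v {..<n})"
        using cross_cancel[of "h (restrict v {..<n})" "y [^] v n" "h (restrict w {..<n})" "y [^] w n"]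
          eq hc[OF v] hc[OF w] y unfolding f_def by simp
      also have "\<dots> = h (inv\<^bsub>?C\<^esub> (restrict w {..<n}) \<otimes>\<^bsub>?C\<^esub> restrict v {..<n})"
        using res[OF v] res[OF w] by simp
      also have "\<dots> \<in> h ` carrier ?C" using res[OF v] res[OF w] by blast
      finally have mem: "y [^] (w n - v n) \<in> h ` carrier ?C" .
      have vn: "v n = w n"
      proof (rule ccontr)
        assume "v n \<noteq> w n"
        then have "\<not> int p dvd w n - v n"
          using lt dvd_imp_le_int[of "w n - v n" "int p"] by linarith
        then have "y \<in> h ` carrier ?C"
          using subgroup_mem_if_pow_mem[OF h.img_is_subgroup y(1) p exp[OF y(1)]] mem by blast
        then show False using y by blast
      qed
      then have "h (restrict v {..<n}) = h (restrict w {..<n})"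
        using eq hc[OF v] hc[OF w] y unfolding f_def by simp
      then have r: "restrict v {..<n} = restrict w {..<n}"
        using inj_onD[OF h(2)] res[OF v] res[OF w] by blast
      show "v = w"
      proof
        fix i
        consider "i < n" | "i = n" | "i > n" by linarith
        then show "v i = w i"
        proof cases
          case 1
          then show ?thesis using fun_cong[OF r, of i] by simp
        next
          case 3
          then show ?thesis
            using PiE_arb[OF v[unfolded carrier_cyclic_power[OF p0]], of i]
              PiE_arb[OF w[unfolded carrier_cyclic_power[OF p0]], of i] by simp
        qed (use vn in simp)
      qed
    qed
    ultimately have "Q (Suc n)" unfolding Q_def by blast
    then show False using nmax[of "Suc n"] by simp
  qed
  then have "h \<in> iso ?C G" using h unfolding iso_def bij_betw_def by blast
  then show ?thesis by blast
qed

section \<open>Classification of the groups with a scalar kernel\<close>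

text \<open>
  The familiar argument that a linear map for which every vector is an eigenvector is a scalar, in
  multiplicative notation: compare the exponents of \<open>a\<close>, of an independent \<open>x\<close> and of \<open>x \<otimes> a\<close>.
\<close>

lemma (in group) power_automorphism_uniform:
  fixes p :: nat
  assumes N: "subgroup N G" and g: "g \<in> carrier G"
    and comm: "\<And>x y. \<lbrakk>x \<in> N; y \<in> N\<rbrakk> \<Longrightarrow> x \<otimes> y = y \<otimes> x"
    and p: "Factorial_Ring.prime p" and exp: "\<And>x. x \<in> N \<Longrightarrow> x [^] p = \<one>"
    and scal: "\<And>x. x \<in> N \<Longrightarrow> \<exists>k::int. g \<otimes> x = x [^] k \<otimes> g"
  shows "\<exists>k::int. \<forall>x \<in> N. g \<otimes> x \<otimes> inv g = x [^] k"
proof (cases "N \<subseteq> {\<one>}")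
  case True
  then have "g \<otimes> x \<otimes> inv g = x [^] (0::int)" if "x \<in> N" for x
    using that g by auto
  then show ?thesis by blast
next
  case False
  have Nc: "x \<in> carrier G" if "x \<in> N" for x using that subgroup.subset[OF N] by blast
  have conj: "\<exists>k::int. g \<otimes> x \<otimes> inv g = x [^] k" if "x \<in> N" for x
  proof -
    obtain k :: int where "g \<otimes> x = x [^] k \<otimes> g" using scal \<open>x \<in> N\<close> by blast
    then have "g \<otimes> x \<otimes> inv g = x [^] k" using g Nc[OF that] by (simp add: m_assoc)
    then show ?thesis by blast
  qed
  \<comment> \<open>The exponent that belongs to one nontrivial element \<open>a\<close> works for all elements.\<close>
  obtain a where a: "a \<in> N" "a \<noteq> \<one>" using False by blast
  obtain k :: int where k: "g \<otimes> a \<otimes> inv g = a [^] k" using conj[OF a(1)] by blast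
  have ac: "a \<in> carrier G" using Nc a by blast
  have "g \<otimes> x \<otimes> inv g = x [^] k" if x: "x \<in> N" for x
  proof (cases "x \<in> generate G {a}")
    case True
    then obtain i :: int where i: "x = a [^] i" using generate_singletonE[OF ac] by blast
    have "g \<otimes> x \<otimes> inv g = (g \<otimes> a \<otimes> inv g) [^] i"
      using conj_int_pow[OF g ac] i by simp
    then show ?thesis using i k ac by (simp add: int_pow_pow mult.commute)
  next
    case False
    have xc: "x \<in> carrier G" using Nc x by blast
    obtain l :: int where l: "g \<otimes> x \<otimes> inv g = x [^] l" using conj[OF x] by blast
    have xa: "x \<otimes> a \<in> N" using subgroup.m_closed[OF N x a(1)] .
    obtain m :: int where m: "g \<otimes> (x \<otimes> a) \<otimes> inv g = (x \<otimes> a) [^] m" using conj[OF xa] by blast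
    have "x [^] m \<otimes> a [^] m = (x \<otimes> a) [^] m"
      using int_pow_mult_distrib[OF comm[OF x a(1)] xc ac] by simp
    also have "\<dots> = (g \<otimes> x \<otimes> inv g) \<otimes> (g \<otimes> a \<otimes> inv g)"
      unfolding m[symmetric] using g xc ac by (simp add: m_assoc) (simp add: m_assoc[symmetric])
    also have "\<dots> = x [^] l \<otimes> a [^] k" using k l by simp
    finally have eq: "x [^] m \<otimes> a [^] m = x [^] l \<otimes> a [^] k" .
    have "x [^] (m - l) = inv (x [^] l) \<otimes> x [^] m"
      using xc int_pow_mult[of x "- l" m] by (simp add: int_pow_neg)
    also have "\<dots> = a [^] k \<otimes> inv (a [^] m)"
      using cross_cancel[OF _ _ _ _ eq] xc ac by simp
    also have "\<dots> = a [^] (k - m)" using int_pow_diff ac by simp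
    finally have xa_eq: "x [^] (m - l) = a [^] (k - m)" .
    then have "x [^] (m - l) \<in> generate G {a}" using int_pow_in_generate[OF ac] by simp
    then have d1: "int p dvd m - l"
      using subgroup_mem_if_pow_mem[OF generate_is_subgroup xc p exp[OF x], of "{a}" "m - l"] False ac
      by blast
    have xpow: "z [^] i = z [^] j" if z: "z \<in> N" and ij: "int p dvd i - j" for z and i j :: int
    proof -
      obtain t where "i - j = int p * t" using ij by blast
      then have i: "i = int p * t + j" by simp
      have "z [^] (int p * t) = (z [^] p) [^] t"
        using Nc[OF z] by (simp add: int_pow_pow flip: int_pow_int)
      then have "z [^] (int p * t) = \<one>" using exp[OF z] by simp
      then show ?thesis using Nc[OF z] by (simp add: i int_pow_mult)
    qed
    have "x [^] (m - l) = \<one>" using xpow[OF x, of "m - l" 0] d1 by simp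
    then have "a [^] (k - m) = \<one>" using xa_eq by simp
    then have "int p dvd k - m"
      using subgroup_mem_if_pow_mem[OF triv_subgroup ac p exp[OF a(1)], of "k - m"] a(2) by blast
    then have "int p dvd (k - m) + (m - l)" using d1 by (rule dvd_add)
    then have "x [^] k = x [^] l" using xpow[OF x, of k l] by simp
    then show ?thesis using l by simp
  qed
  then show ?thesis by blast
qed

lemma generate_one_integer_mod_group:
  assumes "1 < q"
  shows "generate (integer_mod_group q) {1} = carrier (integer_mod_group q)"
proof -
  interpret Z: group "integer_mod_group q" by simp
  have one: "1 \<in> carrier (integer_mod_group q)" using assms by simp
  show ?thesis
  proof (intro equalityI Z.generate_incl subsetI)
    fix j assume "j \<in> carrier (integer_mod_group q)"
    then have "0 \<le> j" "j < int q" using assms by (auto simp: carrier_integer_mod_group)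
    then have "j = 1 [^]\<^bsub>integer_mod_group q\<^esub> j" by (simp add: int_pow_integer_mod_group)
    then show "j \<in> generate (integer_mod_group q) {1}"
      using Z.int_pow_in_generate[OF one, of j] by simp
  qed (use one in auto)
qed

text \<open>
  The hypothesis makes \<open>k ^ j\<close>, as an exponent, depend only on \<open>j\<close> modulo \<open>q\<close>. The restriction to the carrier is needed
  because the members of \<open>AutoGroup\<close> are extensional functions.
\<close>

lemma (in comm_group) power_action_hom_AutoGroup:
  fixes k :: int and q :: nat
  assumes q: "1 < q" and kq: "\<And>v. v \<in> carrier G \<Longrightarrow> v [^] (k ^ q) = v"
  defines "\<phi> \<equiv> \<lambda>j::int. \<lambda>v\<in>carrier G. v [^] (k ^ nat j)"
  shows "\<phi> \<in> hom (integer_mod_group q) (AutoGroup G)"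
proof -
  have cyc: "v [^] (k ^ (q * t)) = v" if "v \<in> carrier G" for v and t :: nat
  proof (induction t)
    case (Suc t)
    have "v [^] (k ^ (q * Suc t)) = (v [^] (k ^ q)) [^] (k ^ (q * t))"
      using that by (simp add: int_pow_pow power_add)
    then show ?case using Suc kq[OF that] by simp
  qed (use that in simp)
  have modq: "v [^] (k ^ (a mod q)) = v [^] (k ^ a)" if v: "v \<in> carrier G" for v and a :: nat
  proof -
    have "v [^] (k ^ a) = v [^] (k ^ (q * (a div q)) * k ^ (a mod q))"
      by (simp flip: power_add)
    also have "\<dots> = (v [^] (k ^ (q * (a div q)))) [^] (k ^ (a mod q))"
      using v by (simp add: int_pow_pow)
    finally show ?thesis using cyc[OF v] by simp
  qed
  have comp: "\<phi> i (\<phi> j v) = \<phi> ((i + j) mod int q) v"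
    if "0 \<le> i" "0 \<le> j" and v: "v \<in> carrier G" for i j v
  proof -
    have "nat ((i + j) mod int q) = (nat i + nat j) mod q"
      using that by (simp add: nat_mod_distrib nat_add_distrib)
    then show ?thesis
      unfolding \<phi>_def using v
      by (simp add: modq int_pow_pow power_add mult.commute)
  qed
  have zero: "\<phi> 0 v = v" if "v \<in> carrier G" for v
    unfolding \<phi>_def using that by simp
  have clo: "\<phi> j v \<in> carrier G" if "v \<in> carrier G" for j v
    unfolding \<phi>_def using that by simp
  have aut: "\<phi> j \<in> auto G" if j: "0 \<le> j" "j < int q" for j
  proof -
    have "\<phi> j \<in> hom G G"
      unfolding \<phi>_def by (rule homI) (auto simp: int_pow_distrib)
    moreover have "\<phi> j \<in> extensional (carrier G)" unfolding \<phi>_def by simp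
    moreover have "bij_betw (\<phi> j) (carrier G) (carrier G)"
    proof (rule bij_betw_byWitness[where f' = "\<phi> ((int q - j) mod int q)"])
      have m: "0 \<le> (int q - j) mod int q" using q by simp
      have z: "((int q - j) mod int q + j) mod int q = 0" "(j + (int q - j) mod int q) mod int q = 0"
        by (simp_all add: mod_add_left_eq mod_add_right_eq)
      show "\<forall>v\<in>carrier G. \<phi> ((int q - j) mod int q) (\<phi> j v) = v"
        using comp[OF m j(1)] z zero by simp
      show "\<forall>v\<in>carrier G. \<phi> j (\<phi> ((int q - j) mod int q) v) = v"
        using comp[OF j(1) m] z zero by simp
    qed (use clo in auto)
    ultimately show ?thesis unfolding auto_def Bij_def by simp
  qed
  show ?thesis
  proof (rule homI)
    show "\<phi> i \<in> carrier (AutoGroup G)" if "i \<in> carrier (integer_mod_group q)" for i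
      using that aut q by (simp add: AutoGroup_def carrier_integer_mod_group)
    fix i j assume "i \<in> carrier (integer_mod_group q)" "j \<in> carrier (integer_mod_group q)"
    then have ij: "0 \<le> i" "i < int q" "0 \<le> j" "j < int q"
      using q by (auto simp: carrier_integer_mod_group)
    have "\<phi> ((i + j) mod int q) = compose (carrier G) (\<phi> i) (\<phi> j)"
    proof
      fix v
      show "\<phi> ((i + j) mod int q) v = compose (carrier G) (\<phi> i) (\<phi> j) v"
        using comp[OF ij(1,3), of v] by (cases "v \<in> carrier G") (auto simp: compose_def \<phi>_def)
    qed
    moreover have "\<phi> i \<in> Bij (carrier G)" "\<phi> j \<in> Bij (carrier G)"
      using aut ij by (auto simp: auto_def)
    ultimately show "\<phi> (i \<otimes>\<^bsub>integer_mod_group q\<^esub> j) = \<phi> i \<otimes>\<^bsub>AutoGroup G\<^esub> \<phi> j"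
      by (simp add: AutoGroup_def BijGroup_def)
  qed
qed

lemma (in group) commutative_if_generator_centralizes:
  assumes N: "subgroup N G" and y: "y \<in> carrier G"
    and comm: "\<And>x z. \<lbrakk>x \<in> N; z \<in> N\<rbrakk> \<Longrightarrow> x \<otimes> z = z \<otimes> x"
    and c: "\<And>x. x \<in> N \<Longrightarrow> y \<otimes> x = x \<otimes> y"
    and dec: "\<And>x. x \<in> carrier G \<Longrightarrow> \<exists>n \<in> N. \<exists>j::nat. x = n \<otimes> y [^] j"
    and ab: "a \<in> carrier G" "b \<in> carrier G"
  shows "a \<otimes> b = b \<otimes> a"
proof -
  have cy: "y [^] (j::nat) \<otimes> x = x \<otimes> y [^] j" if x: "x \<in> N" for x j
    by (rule group_commutes_pow) (use c[OF x] x y subgroup.subset[OF N] in auto)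
  obtain n and i :: nat where n: "n \<in> N" "a = n \<otimes> y [^] i" using dec[OF ab(1)] by blast
  obtain m and j :: nat where m: "m \<in> N" "b = m \<otimes> y [^] j" using dec[OF ab(2)] by blast
  have nc: "n \<in> carrier G" and mc: "m \<in> carrier G" using n m subgroup.subset[OF N] by blast+
  have "a \<otimes> b = n \<otimes> (y [^] i \<otimes> m) \<otimes> y [^] j" using n m nc mc y by (simp add: m_assoc)
  also have "\<dots> = (n \<otimes> m) \<otimes> (y [^] i \<otimes> y [^] j)"
    unfolding cy[OF m(1)] using nc mc y by (simp add: m_assoc)
  also have "\<dots> = (m \<otimes> n) \<otimes> (y [^] j \<otimes> y [^] i)"
    unfolding comm[OF n(1) m(1)] using y by (simp add: nat_pow_mult add.commute)
  also have "\<dots> = m \<otimes> (y [^] j \<otimes> n) \<otimes> y [^] i"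
    unfolding cy[OF n(1)] using nc mc y by (simp add: m_assoc)
  also have "\<dots> = b \<otimes> a" using n m nc mc y by (simp add: m_assoc)
  finally show ?thesis .
qed

text \<open>
  If \<open>G\<close> is not abelian, it is not equal to its kernel \<open>N\<close>, and any \<open>y\<close> outside \<open>N\<close> generates \<open>G\<close> together with
  \<open>N\<close>. With an isomorphism \<open>h\<close> from \<open>(C\<^sub>p)\<^sup>m\<close> to \<open>N\<close>, the map \<open>(v, j) \<mapsto> h v \<otimes> y [^] j\<close> is an isomorphism from
  the semidirect product. The scalar \<open>k\<close> by which \<open>y\<close> acts is not \<open>1\<close>, since otherwise \<open>y\<close> would centralize \<open>N\<close>
  and \<open>G\<close> would be abelian.
\<close>

lemma (in group) scalar_kernel_classification:
  assumes fin: "finite (carrier G)" and sk: "scalar_kernel G N"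
  shows "(\<exists>(p::nat) (d::nat). Factorial_Ring.prime p \<and> G \<cong> cyclic_power p d) \<or>
    (\<exists>(p::nat) (q::nat) (d::nat) \<phi>. Factorial_Ring.prime p \<and> Factorial_Ring.prime q \<and> d \<ge> 2 \<and>
       \<phi> \<in> hom (integer_mod_group q) (AutoGroup (cyclic_power p (d - 1))) \<and>
       acts_as_nontrivial_scalar p (d - 1) q \<phi> \<and>
       G \<cong> semidirect_product (cyclic_power p (d - 1)) (integer_mod_group q) \<phi>)"
proof (cases "\<forall>x \<in> carrier G. \<forall>y \<in> carrier G. x \<otimes> y = y \<otimes> x")
  case True
  then have comm: "x \<otimes> y = y \<otimes> x" if "x \<in> carrier G" "y \<in> carrier G" for x y
    using that by blast
  obtain p :: nat where p: "Factorial_Ring.prime p" "\<forall>x \<in> carrier G. x [^] p = \<one>"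
    using commuting_elements_common_prime_exponent[OF subset_refl comm scalar_kernelD(2)[OF sk]] by blast
  then obtain n h where "h \<in> iso (cyclic_power p n) G"
    using elementary_abelian_iso_cyclic_power[OF fin p(1) comm] by blast
  then have "G \<cong> cyclic_power p n"
    using group.iso_sym[OF group_cyclic_power] by (auto simp: is_iso_def)
  then show ?thesis using p(1) by blast
next
  case False
  note subN = scalar_kernelD(1)[OF sk] and Nc = scalar_kernelD(5)[OF sk]
  note commN = scalar_kernel_commute[OF sk]
  obtain p :: nat where p: "Factorial_Ring.prime p" and exp: "\<And>x. x \<in> N \<Longrightarrow> x [^] p = \<one>"
    using commuting_elements_common_prime_exponent[OF subgroup.subset[OF subN] commN scalar_kernelD(2)[OF sk]]
    by blast
  have "carrier G \<noteq> N" using False commN by blast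
  then obtain y where y: "y \<in> carrier G" "y \<notin> N" using Nc by blast
  obtain k :: int where k: "\<And>x. x \<in> N \<Longrightarrow> y \<otimes> x \<otimes> inv y = x [^] k"
    using power_automorphism_uniform[OF subN y(1) commN p exp scalar_kernelD(3)[OF sk _ y(1)]] by blast
  have kpow: "y [^] j \<otimes> x = x [^] (k ^ j) \<otimes> y [^] j" if "x \<in> N" for x and j :: nat
  proof (rule commutation_pow_left[OF y(1) Nc[OF that]])
    show "y \<otimes> x = x [^] k \<otimes> y"
      using k[OF that] y(1) Nc[OF that] inv_solve_right' by (metis int_pow_closed m_closed)
  qed
  obtain q :: nat where q: "Factorial_Ring.prime q" "y [^] q = \<one>"
    using scalar_kernelD(2)[OF sk y(1)] by blast
  have q1: "1 < q" using prime_gt_1_nat[OF q(1)] .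
  have ydec: "\<exists>n \<in> N. \<exists>j::nat. x = n \<otimes> y [^] j" if x: "x \<in> carrier G" for x
  proof (cases "x \<in> N")
    case True
    then show ?thesis using x by (intro bexI[of _ x] exI[of _ 0]) auto
  qed (use scalar_kernelD(4)[OF sk x _ y] in blast)
  \<comment> \<open>This \<open>a\<close> detects that the scalar \<open>k\<close> is neither \<open>0\<close> nor \<open>1\<close>.\<close>
  have "\<exists>a \<in> N. y \<otimes> a \<noteq> a \<otimes> y"
  proof (rule ccontr)
    assume "\<not> ?thesis"
    then have c: "y \<otimes> x = x \<otimes> y" if "x \<in> N" for x using that by blast
    show False using False commutative_if_generator_centralizes[OF subN y(1) commN c ydec] by blast
  qed
  then obtain a where a: "a \<in> N" "y \<otimes> a \<noteq> a \<otimes> y" by blast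
  note ac = Nc[OF a(1)]
  have a1: "a \<noteq> \<one>" using a y by auto
  have ya: "y \<otimes> a = a [^] k \<otimes> y" using kpow[OF a(1), of 1] y by simp
  have apow: "a [^] i = a [^] j" if "[i = j] (mod int p)" for i j :: int
  proof -
    have "int (ord a) dvd int p" using exp[OF a(1)] pow_eq_id[OF ac] by simp
    then have "int (ord a) dvd i - j" using that by (meson cong_iff_dvd_diff dvd_trans)
    then have "int (ord a) dvd j - i" by (metis dvd_diff_commute)
    then show ?thesis using int_pow_eq[OF ac] \<open>int (ord a) dvd i - j\<close> by blast
  qed
  have k1: "\<not> [k = 1] (mod int p)"
    using apow[of k 1] ya a(2) ac by auto
  have k0: "\<not> [k = 0] (mod int p)"
  proof
    assume "[k = 0] (mod int p)"
    then have "y \<otimes> a = y \<otimes> \<one>" using apow[of k 0] ya y by simp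
    then show False using a1 ac y by (metis l_cancel one_closed)
  qed
  let ?K = "G\<lparr>carrier := N\<rparr>"
  interpret K: group ?K using subgroup.subgroup_is_group[OF subN is_group] .
  have Kpow: "x [^]\<^bsub>?K\<^esub> (i::nat) = x [^] i" for x i by (simp add: nat_pow_consistent[symmetric])
  obtain m h where h: "h \<in> iso (cyclic_power p m) ?K"
    using K.elementary_abelian_iso_cyclic_power[OF _ p] commN exp fin finite_subset[OF subgroup.subset[OF subN]]
    by (auto simp: Kpow)
  let ?C = "cyclic_power p m"
  interpret C: comm_group ?C by (rule comm_group_cyclic_power)
  have hbij: "bij_betw h (carrier ?C) N" and hhom: "h \<in> hom ?C G"
    using h subgroup.subset[OF subN] by (auto simp: iso_def hom_def)
  have hN: "h v \<in> N" if "v \<in> carrier ?C" for v using bij_betwE[OF hbij] that by blast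
  have hpow: "h (v [^]\<^bsub>?C\<^esub> i) = h v [^] i" if "v \<in> carrier ?C" for v and i :: int
    using hom_int_pow[OF hhom that C.is_group is_group] .
  have kq: "v [^]\<^bsub>?C\<^esub> (k ^ q) = v" if v: "v \<in> carrier ?C" for v
  proof -
    have "h v = h v [^] (k ^ q)" using kpow[OF hN[OF v], of q] q Nc[OF hN[OF v]] by simp
    then have "h (v [^]\<^bsub>?C\<^esub> (k ^ q)) = h v" using hpow[OF v] by simp
    then show ?thesis using inj_onD[OF bij_betw_imp_inj_on[OF hbij]] v by simp
  qed
  define \<phi> where "\<phi> = (\<lambda>j::int. \<lambda>v\<in>carrier ?C. v [^]\<^bsub>?C\<^esub> (k ^ nat j))"
  have \<phi>hom: "\<phi> \<in> hom (integer_mod_group q) (AutoGroup ?C)"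
    unfolding \<phi>_def by (rule C.power_action_hom_AutoGroup[OF q1 kq])
  let ?Z = "integer_mod_group q"
  let ?S = "semidirect_product ?C ?Z \<phi>"
  have act: "acts_as_nontrivial_scalar p m q \<phi>"
    unfolding acts_as_nontrivial_scalar_def
  proof (intro bexI[of _ 1] conjI exI[of _ k] k0 k1 ballI)
    show "generate ?Z {1} = carrier ?Z" using generate_one_integer_mod_group[OF q1] .
    show "\<phi> 1 v = v [^]\<^bsub>?C\<^esub> k" if "v \<in> carrier ?C" for v using that by (simp add: \<phi>_def)
    show "1 \<in> carrier ?Z" using q1 by simp
  qed
  \<comment> \<open>\<open>m > 0\<close> is what \<open>d = m + 1 \<ge> 2\<close> demands; it holds because \<open>N\<close> contains \<open>a\<close>.\<close>
  have m0: "m \<noteq> 0"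
  proof
    assume "m = 0"
    then have "card N = 1"
      using bij_betw_same_card[OF hbij] prime_gt_0_nat[OF p] by (simp add: carrier_cyclic_power)
    then show False
      using a(1) a1 subgroup.one_closed[OF subN] by (metis card_1_singletonE singletonD)
  qed
  define f where "f = (\<lambda>(v, j::int). h v \<otimes> y [^] nat j)"
  have Sc: "carrier ?S = carrier ?C \<times> {0..<int q}"
    using q1 by (simp add: semidirect_product_def carrier_integer_mod_group)
  have ymod: "y [^] (i mod q) = y [^] i" for i :: nat
  proof -
    have "y [^] i = (y [^] q) [^] (i div q) \<otimes> y [^] (i mod q)"
      using y by (simp add: nat_pow_pow nat_pow_mult)
    then show ?thesis using q y by simp
  qed
  have "f \<in> hom ?S G"
  proof (rule homI)
    show "f s \<in> carrier G" if "s \<in> carrier ?S" for s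
      using that hN Nc y unfolding Sc f_def by auto
    fix s t assume "s \<in> carrier ?S" "t \<in> carrier ?S"
    then obtain v i w j where s: "s = (v, i)" "v \<in> carrier ?C" "0 \<le> i"
      and t: "t = (w, j)" "w \<in> carrier ?C" "0 \<le> j" unfolding Sc by auto
    have vc: "h v \<in> carrier G" and wc: "h w \<in> carrier G" using hN Nc s t by blast+
    have "nat ((i + j) mod int q) = (nat i + nat j) mod q"
      using s t by (simp add: nat_mod_distrib nat_add_distrib)
    then have "f (s \<otimes>\<^bsub>?S\<^esub> t) = h (v \<otimes>\<^bsub>?C\<^esub> (w [^]\<^bsub>?C\<^esub> (k ^ nat i))) \<otimes> y [^] (nat i + nat j)"
      using s t y by (simp add: f_def semidirect_product_def \<phi>_def ymod)
    also have "y [^] (nat i + nat j) = y [^] nat i \<otimes> y [^] nat j"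
      by (rule nat_pow_mult[OF y(1), symmetric])
    also have "h (v \<otimes>\<^bsub>?C\<^esub> (w [^]\<^bsub>?C\<^esub> (k ^ nat i))) \<otimes> (y [^] nat i \<otimes> y [^] nat j)
        = h v \<otimes> h w [^] (k ^ nat i) \<otimes> (y [^] nat i \<otimes> y [^] nat j)"
      using s t by (simp add: hom_mult[OF hhom] hpow)
    also have "\<dots> = h v \<otimes> (h w [^] (k ^ nat i) \<otimes> y [^] nat i) \<otimes> y [^] nat j"
      using s t y vc wc by (simp add: m_assoc)
    also have "\<dots> = h v \<otimes> (y [^] nat i \<otimes> h w) \<otimes> y [^] nat j"
      using kpow[OF hN[OF t(2)]] by simp
    also have "\<dots> = f s \<otimes> f t"
      using s t vc wc y by (simp add: f_def m_assoc)
    finally show "f (s \<otimes>\<^bsub>?S\<^esub> t) = f s \<otimes> f t" .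
  qed
  moreover have "bij_betw f (carrier ?S) (carrier G)"
    unfolding bij_betw_def
  proof
    show "inj_on f (carrier ?S)"
    proof (rule inj_onI)
      fix s t assume st: "s \<in> carrier ?S" "t \<in> carrier ?S" and eq: "f s = f t"
      obtain v i w j where s: "s = (v, i)" "v \<in> carrier ?C" "0 \<le> i" "i < int q"
        and t: "t = (w, j)" "w \<in> carrier ?C" "0 \<le> j" "j < int q" using st unfolding Sc by auto
      have vc: "h v \<in> carrier G" and wc: "h w \<in> carrier G" using hN Nc s t by blast+
      have eq': "h v \<otimes> y [^] i = h w \<otimes> y [^] j"
        using eq s t int_pow_int[of G y "nat i"] int_pow_int[of G y "nat j"] by (simp add: f_def)
      have "y [^] (j - i) = y [^] j \<otimes> inv (y [^] i)" using int_pow_diff[OF y(1)] .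
      also have "\<dots> = inv (h w) \<otimes> h v"
        using cross_cancel[OF _ _ _ _ eq'] vc wc y by simp
      also have "\<dots> \<in> N"
        using subgroup.m_closed[OF subN subgroup.m_inv_closed[OF subN hN[OF t(2)]] hN[OF s(2)]] .
      finally have "y [^] (j - i) \<in> N" .
      then have "int q dvd j - i"
        using subgroup_mem_if_pow_mem[OF subN y(1) q] y(2) by blast
      then have ij: "i = j" using s t dvd_imp_le_int[of "j - i" "int q"] by linarith
      then have "h v = h w" using eq' vc wc y by simp
      then have "v = w" using inj_onD[OF bij_betw_imp_inj_on[OF hbij]] s t by blast
      then show "s = t" using s t ij by simp
    qed
    show "f ` carrier ?S = carrier G"
    proof (intro equalityI subsetI)
      fix x assume "x \<in> f ` carrier ?S"
      then show "x \<in> carrier G" using hN Nc y unfolding Sc f_def by auto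
    next
      fix x assume "x \<in> carrier G"
      then obtain n and j :: nat where n: "n \<in> N" "x = n \<otimes> y [^] j" using ydec by blast
      obtain v where v: "v \<in> carrier ?C" "n = h v" using n(1) bij_betw_imp_surj_on[OF hbij] by blast
      have "x = f (v, int (j mod q))" using n v ymod by (simp add: f_def)
      moreover have "(v, int (j mod q)) \<in> carrier ?S" unfolding Sc using v q1 by simp
      ultimately show "x \<in> f ` carrier ?S" by blast
    qed
  qed
  ultimately have "f \<in> iso ?S G" by (simp add: iso_def)
  then have "?S \<cong> G" by (auto simp: is_iso_def)
  then have "G \<cong> ?S"
    using group.iso_sym[OF group_semidirect_product[OF C.is_group group_integer_mod_group \<phi>hom]] by blast
  then have "\<exists>d \<phi>. d \<ge> 2 \<and> \<phi> \<in> hom (integer_mod_group q) (AutoGroup (cyclic_power p (d - 1))) \<and>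
       acts_as_nontrivial_scalar p (d - 1) q \<phi> \<and>
       G \<cong> semidirect_product (cyclic_power p (d - 1)) (integer_mod_group q) \<phi>"
    using act \<phi>hom m0 by (intro exI[of _ "Suc m"] exI[of _ \<phi>]) simp
  then show ?thesis using p q(1) by blast
qed

section \<open>Scalar kernels of the two families\<close>

lemma scalar_kernel_iso_transfer:
  assumes G: "group G" and S: "group S" and h: "h \<in> iso G S" and sk: "scalar_kernel S M"
  shows "scalar_kernel G {g \<in> carrier G. h g \<in> M}" (is "scalar_kernel G ?N")
proof -
  interpret G: group G by (rule G)
  interpret S: group S by (rule S)
  interpret h: group_hom G S h
    using h G S by (simp add: group_hom_def group_hom_axioms_def iso_def)
  have bij: "bij_betw h (carrier G) (carrier S)" using h by (simp add: iso_def)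
  note inj = inj_onD[OF bij_betw_imp_inj_on[OF bij]]
  note M = scalar_kernelD[OF sk]
  have lift: "\<exists>n \<in> ?N. h n = m" if "m \<in> M" for m
  proof -
    have "m \<in> h ` carrier G" using M(5)[OF that] bij_betw_imp_surj_on[OF bij] by simp
    then show ?thesis using that by auto
  qed
  show ?thesis
    unfolding scalar_kernel_def
  proof (intro conjI ballI)
    show "subgroup ?N G"
    proof (rule G.subgroupI)
      show "?N \<subseteq> carrier G" by blast
      have "\<one>\<^bsub>G\<^esub> \<in> ?N" using subgroup.one_closed[OF M(1)] by simp
      then show "?N \<noteq> {}" by blast
      show "inv\<^bsub>G\<^esub> a \<in> ?N" if "a \<in> ?N" for a
        using that subgroup.m_inv_closed[OF M(1)] by simp
      show "a \<otimes>\<^bsub>G\<^esub> b \<in> ?N" if "a \<in> ?N" "b \<in> ?N" for a b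
        using that subgroup.m_closed[OF M(1)] by simp
    qed
  next
    fix x assume x: "x \<in> carrier G"
    then obtain r :: nat where r: "Factorial_Ring.prime r" "h x [^]\<^bsub>S\<^esub> r = \<one>\<^bsub>S\<^esub>"
      using M(2)[of "h x"] by auto
    then have "h (x [^]\<^bsub>G\<^esub> r) = h \<one>\<^bsub>G\<^esub>" using x by (simp add: h.hom_nat_pow)
    then have "x [^]\<^bsub>G\<^esub> r = \<one>\<^bsub>G\<^esub>" using inj x by blast
    then show "\<exists>r::nat. Factorial_Ring.prime r \<and> x [^]\<^bsub>G\<^esub> r = \<one>\<^bsub>G\<^esub>" using r(1) by blast
  next
    fix x g assume x: "x \<in> ?N" and g: "g \<in> carrier G"
    obtain k :: int where "h g \<otimes>\<^bsub>S\<^esub> h x = h x [^]\<^bsub>S\<^esub> k \<otimes>\<^bsub>S\<^esub> h g"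
      using M(3)[of "h x" "h g"] x g by auto
    then have "h (g \<otimes>\<^bsub>G\<^esub> x) = h (x [^]\<^bsub>G\<^esub> k \<otimes>\<^bsub>G\<^esub> g)"
      using x g by (simp add: h.hom_int_pow)
    then have "g \<otimes>\<^bsub>G\<^esub> x = x [^]\<^bsub>G\<^esub> k \<otimes>\<^bsub>G\<^esub> g"
      using inj[of "g \<otimes>\<^bsub>G\<^esub> x" "x [^]\<^bsub>G\<^esub> k \<otimes>\<^bsub>G\<^esub> g"] x g by simp
    then show "\<exists>k::int. g \<otimes>\<^bsub>G\<^esub> x = x [^]\<^bsub>G\<^esub> k \<otimes>\<^bsub>G\<^esub> g" by blast
  next
    fix x z assume x: "x \<in> carrier G - ?N" and z: "z \<in> carrier G - ?N"
    then have "h x \<in> carrier S" "h x \<notin> M" "h z \<in> carrier S" "h z \<notin> M" by auto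
    then obtain m and j :: nat where m: "m \<in> M" "h x = m \<otimes>\<^bsub>S\<^esub> h z [^]\<^bsub>S\<^esub> j"
      using M(4) by blast
    obtain n where n: "n \<in> ?N" "h n = m" using lift[OF m(1)] by blast
    have "h x = h (n \<otimes>\<^bsub>G\<^esub> z [^]\<^bsub>G\<^esub> j)"
      using m n z by (simp add: h.hom_nat_pow)
    then have "x = n \<otimes>\<^bsub>G\<^esub> z [^]\<^bsub>G\<^esub> j"
      using inj[of x "n \<otimes>\<^bsub>G\<^esub> z [^]\<^bsub>G\<^esub> j"] x n z by simp
    then show "\<exists>n \<in> ?N. \<exists>j::nat. x = n \<otimes>\<^bsub>G\<^esub> z [^]\<^bsub>G\<^esub> j" using n(1) by blast
  qed
qed

lemma scalar_kernel_cyclic_power: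
  assumes p: "Factorial_Ring.prime p"
  shows "scalar_kernel (cyclic_power p n) (carrier (cyclic_power p n))"
proof -
  interpret C: comm_group "cyclic_power p n" by (rule comm_group_cyclic_power)
  show ?thesis
    unfolding scalar_kernel_def
  proof (intro conjI ballI C.subgroup_self)
    fix x assume x: "x \<in> carrier (cyclic_power p n)"
    show "\<exists>r::nat. Factorial_Ring.prime r \<and> x [^]\<^bsub>cyclic_power p n\<^esub> r = \<one>\<^bsub>cyclic_power p n\<^esub>"
      using p pow_exponent_cyclic_power[OF x] by (intro exI[of _ p]) simp
    fix g assume g: "g \<in> carrier (cyclic_power p n)"
    show "\<exists>k::int. g \<otimes>\<^bsub>cyclic_power p n\<^esub> x = x [^]\<^bsub>cyclic_power p n\<^esub> k \<otimes>\<^bsub>cyclic_power p n\<^esub> g"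
      using C.m_comm[OF g x] x by (intro exI[of _ 1]) simp
  qed simp
qed

text \<open>
  The crucial property is that a nontrivial element of \<open>C\<^sub>q\<close> fixes no nontrivial element of the normal
  factor: it generates \<open>C\<^sub>q\<close>, and a generator acts as a scalar other than \<open>1\<close>. Now \<open>u [^] q\<close> lies in the normal
  factor and commutes with \<open>u\<close>, so it is trivial for each \<open>u\<close> outside that factor; this gives the prime exponents.
\<close>

lemma scalar_kernel_semidirect_product:
  assumes p: "Factorial_Ring.prime p" and q: "Factorial_Ring.prime q"
    and \<phi>: "\<phi> \<in> hom (integer_mod_group q) (AutoGroup (cyclic_power p m))"
    and act: "acts_as_nontrivial_scalar p m q \<phi>"
  shows "scalar_kernel (semidirect_product (cyclic_power p m) (integer_mod_group q) \<phi>)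
           (carrier (cyclic_power p m) \<times> {0})"
proof -
  let ?C = "cyclic_power p m" and ?Z = "integer_mod_group q"
  let ?S = "semidirect_product ?C ?Z \<phi>"
  let ?M = "carrier ?C \<times> {0::int}"
  interpret C: comm_group ?C by (rule comm_group_cyclic_power)
  interpret Z: comm_group ?Z by simp
  interpret S: group ?S by (rule group_semidirect_product[OF C.is_group Z.is_group \<phi>])
  interpret \<phi>: group_hom ?Z "AutoGroup ?C" \<phi>
    using C.AutoGroup \<phi> by (simp add: group_hom_def group_hom_axioms_def)
  have q0: "0 < q" using prime_gt_0_nat[OF q] .
  have finZ: "finite (carrier ?Z)" using q0 by (simp add: carrier_integer_mod_group)
  have Zexp: "j [^]\<^bsub>?Z\<^esub> q = \<one>\<^bsub>?Z\<^esub>" for j by simp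
  have aut: "\<phi> j \<in> auto ?C" if "j \<in> carrier ?Z" for j
    using \<phi>.hom_closed[OF that] by (simp add: AutoGroup_def)
  have \<phi>hom: "\<phi> j \<in> hom ?C ?C" if "j \<in> carrier ?Z" for j
    using aut[OF that] by (simp add: auto_def)
  have \<phi>cl: "\<phi> j v \<in> carrier ?C" if "j \<in> carrier ?Z" "v \<in> carrier ?C" for j v
    using hom_in_carrier[OF \<phi>hom] that by blast
  have comp: "\<phi> (i \<otimes>\<^bsub>?Z\<^esub> j) v = \<phi> i (\<phi> j v)"
    if "i \<in> carrier ?Z" "j \<in> carrier ?Z" "v \<in> carrier ?C" for i j v
  proof -
    have "\<phi> i \<in> Bij (carrier ?C)" "\<phi> j \<in> Bij (carrier ?C)"
      using aut that by (auto simp: auto_def)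
    then have "\<phi> (i \<otimes>\<^bsub>?Z\<^esub> j) = compose (carrier ?C) (\<phi> i) (\<phi> j)"
      unfolding \<phi>.hom_mult[OF that(1,2)] by (simp add: AutoGroup_def BijGroup_def)
    then show ?thesis using that(3) by (simp only: compose_eq)
  qed
  have \<phi>0: "\<phi> 0 v = v" if "v \<in> carrier ?C" for v
    using that \<phi>.hom_one by (simp add: AutoGroup_def BijGroup_def)
  have Scar: "carrier ?S = carrier ?C \<times> carrier ?Z" by (simp add: semidirect_product_def)
  have Smult: "(v, i) \<otimes>\<^bsub>?S\<^esub> (w, j) = (v \<otimes>\<^bsub>?C\<^esub> \<phi> i w, i \<otimes>\<^bsub>?Z\<^esub> j)" for v i w j
    by (simp add: semidirect_product_def)
  have Sone: "\<one>\<^bsub>?S\<^esub> = (\<one>\<^bsub>?C\<^esub>, 0)" by (simp add: semidirect_product_def)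
  obtain c k where c: "c \<in> carrier ?Z" "generate ?Z {c} = carrier ?Z"
    and k: "\<not> [k = 1] (mod int p)" and \<phi>c: "\<And>v. v \<in> carrier ?C \<Longrightarrow> \<phi> c v = v [^]\<^bsub>?C\<^esub> (k::int)"
    using act unfolding acts_as_nontrivial_scalar_def by blast
  have Cexp: "v [^]\<^bsub>?C\<^esub> p = \<one>\<^bsub>?C\<^esub>" if "v \<in> carrier ?C" for v
    using pow_exponent_cyclic_power[OF that] .
  have \<iota>: "(\<lambda>v. (v, 0)) \<in> hom ?C ?S"
    using \<phi>0 by (intro homI) (auto simp: Scar Smult)
  have snd_hom: "snd \<in> hom ?S ?Z"
    by (rule homI) (auto simp: Scar Smult)
  have scalar: "\<exists>K::int. \<forall>v \<in> carrier ?C. \<phi> j v = v [^]\<^bsub>?C\<^esub> K" if j: "j \<in> carrier ?Z" for j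
  proof -
    have pw: "\<phi> (c [^]\<^bsub>?Z\<^esub> t) v = v [^]\<^bsub>?C\<^esub> (k ^ t)" if v: "v \<in> carrier ?C" for t :: nat and v
    proof (induction t)
      case (Suc t)
      have "\<phi> (c [^]\<^bsub>?Z\<^esub> Suc t) v = \<phi> (c [^]\<^bsub>?Z\<^esub> t) (\<phi> c v)"
        using comp[OF Z.nat_pow_closed[OF c(1)] c(1) v] by (simp only: Z.nat_pow_Suc)
      also have "\<dots> = (\<phi> (c [^]\<^bsub>?Z\<^esub> t) v) [^]\<^bsub>?C\<^esub> k"
        unfolding \<phi>c[OF v]
        by (rule hom_int_pow[OF \<phi>hom[OF Z.nat_pow_closed[OF c(1)]] v C.is_group C.is_group])
      finally show ?case using Suc v by (simp add: C.int_pow_pow mult.commute)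
    qed (use \<phi>0 v in simp)
    obtain t :: nat where "j = c [^]\<^bsub>?Z\<^esub> t"
      using Z.generate_singleton_nat[OF finZ c(1)] c(2) j by blast
    then show ?thesis using pw by blast
  qed
  have gen: "generate ?Z {j} = carrier ?Z" if j: "j \<in> carrier ?Z" "j \<noteq> 0" for j
    using Z.prime_cyclic_generate_eq[OF c(1) q Zexp] j c(2) by simp
  have free: "w = \<one>\<^bsub>?C\<^esub>" if j: "j \<in> carrier ?Z" "j \<noteq> 0" and w: "w \<in> carrier ?C" "\<phi> j w = w" for j w
  proof -
    obtain t :: nat where t: "c = j [^]\<^bsub>?Z\<^esub> t"
      using Z.generate_singleton_nat[OF finZ j(1)] gen[OF j] c(1) by blast
    have "\<phi> (j [^]\<^bsub>?Z\<^esub> s) w = w" for s :: nat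
    proof (induction s)
      case (Suc s)
      then show ?case
        using comp[OF Z.nat_pow_closed[OF j(1)] j(1) w(1)] w(2) by (simp only: Z.nat_pow_Suc)
    qed (use \<phi>0 w in simp)
    then have "w [^]\<^bsub>?C\<^esub> k = w" unfolding \<phi>c[OF w(1), symmetric] t .
    then have "w [^]\<^bsub>?C\<^esub> (k - 1) = \<one>\<^bsub>?C\<^esub>"
      using w(1) C.int_pow_diff[of w k 1] by simp
    moreover have "\<not> int p dvd k - 1" using k by (simp add: cong_iff_dvd_diff)
    ultimately show ?thesis
      using C.subgroup_mem_if_pow_mem[OF C.triv_subgroup w(1) p Cexp[OF w(1)], of "k - 1"] by simp
  qed
  have subM: "subgroup ?M ?S"
  proof -
    interpret \<iota>: group_hom ?C ?S "\<lambda>v. (v, 0)"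
      using \<iota> by (simp add: group_hom_def group_hom_axioms_def)
    have "(\<lambda>v. (v, 0)) ` carrier ?C = ?M" by auto
    then show ?thesis using \<iota>.img_is_subgroup by simp
  qed
  show ?thesis
    unfolding scalar_kernel_def
  proof (intro conjI ballI subM)
    fix u assume u: "u \<in> carrier ?S"
    then obtain v j where vj: "u = (v, j)" "v \<in> carrier ?C" "j \<in> carrier ?Z" unfolding Scar by auto
    show "\<exists>r::nat. Factorial_Ring.prime r \<and> u [^]\<^bsub>?S\<^esub> r = \<one>\<^bsub>?S\<^esub>"
    proof (cases "j = 0")
      case True
      have "u [^]\<^bsub>?S\<^esub> p = (v [^]\<^bsub>?C\<^esub> p, 0)"
        using hom_nat_pow[OF \<iota> vj(2) C.is_group S.is_group] vj(1) True by simp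
      then show ?thesis using p Cexp[OF vj(2)] Sone by auto
    next
      case False
      have "snd (u [^]\<^bsub>?S\<^esub> q) = 0"
        using hom_nat_pow[OF snd_hom u S.is_group Z.is_group, of q] by simp
      moreover have "u [^]\<^bsub>?S\<^esub> q \<in> carrier ?S" using u by simp
      ultimately obtain w where w: "u [^]\<^bsub>?S\<^esub> q = (w, 0)" "w \<in> carrier ?C" unfolding Scar by auto
      have "u \<otimes>\<^bsub>?S\<^esub> u [^]\<^bsub>?S\<^esub> q = u [^]\<^bsub>?S\<^esub> q \<otimes>\<^bsub>?S\<^esub> u"
        using S.group_commutes_pow[of u u q] u by simp
      then have "v \<otimes>\<^bsub>?C\<^esub> \<phi> j w = w \<otimes>\<^bsub>?C\<^esub> v"
        using vj w \<phi>0 by (simp add: Smult)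
      then have "v \<otimes>\<^bsub>?C\<^esub> \<phi> j w = v \<otimes>\<^bsub>?C\<^esub> w" using C.m_comm[OF w(2) vj(2)] by simp
      then have "\<phi> j w = w" using vj w \<phi>cl[OF vj(3) w(2)] by simp
      then have "w = \<one>\<^bsub>?C\<^esub>" using free[OF vj(3) False w(2)] by simp
      then show ?thesis using w Sone q by auto
    qed
  next
    fix x g assume "x \<in> ?M" "g \<in> carrier ?S"
    then obtain v w j where x: "x = (v, 0)" "v \<in> carrier ?C"
      and g: "g = (w, j)" "w \<in> carrier ?C" "j \<in> carrier ?Z" unfolding Scar by auto
    obtain K :: int where K: "\<phi> j v = v [^]\<^bsub>?C\<^esub> K" using scalar[OF g(3)] x by blast
    have vK: "v [^]\<^bsub>?C\<^esub> K \<in> carrier ?C" using x by simp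
    have "x [^]\<^bsub>?S\<^esub> K = (v [^]\<^bsub>?C\<^esub> K, 0)"
      using hom_int_pow[OF \<iota> x(2) C.is_group S.is_group, of K] x(1) by simp
    moreover have "w \<otimes>\<^bsub>?C\<^esub> v [^]\<^bsub>?C\<^esub> K = v [^]\<^bsub>?C\<^esub> K \<otimes>\<^bsub>?C\<^esub> w"
      using C.m_comm[OF g(2) vK] .
    ultimately have "g \<otimes>\<^bsub>?S\<^esub> x = x [^]\<^bsub>?S\<^esub> K \<otimes>\<^bsub>?S\<^esub> g"
      using x g K \<phi>0[OF g(2)] by (simp add: Smult)
    then show "\<exists>K::int. g \<otimes>\<^bsub>?S\<^esub> x = x [^]\<^bsub>?S\<^esub> K \<otimes>\<^bsub>?S\<^esub> g" by blast
  next
    fix x z assume x: "x \<in> carrier ?S - ?M" and z: "z \<in> carrier ?S - ?M"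
    have xc: "x \<in> carrier ?S" and zc: "z \<in> carrier ?S" using x z by auto
    have xs: "snd x \<in> carrier ?Z" and zs: "snd z \<in> carrier ?Z" "snd z \<noteq> 0"
      using xc zc z unfolding Scar by (simp_all add: mem_Times_iff)
    obtain t :: nat where t: "snd x = snd z [^]\<^bsub>?Z\<^esub> t"
      using Z.generate_singleton_nat[OF finZ zs(1)] gen[OF zs] xs by blast
    \<comment> \<open>\<open>t\<close> is chosen such that \<open>x\<close> and \<open>?zt\<close> have the same second component.\<close>
    let ?zt = "z [^]\<^bsub>?S\<^esub> t"
    let ?n = "x \<otimes>\<^bsub>?S\<^esub> inv\<^bsub>?S\<^esub> ?zt"
    have ztc: "?zt \<in> carrier ?S" using zc by simp
    interpret sh: group_hom ?S ?Z snd
      using snd_hom by (simp add: group_hom_def group_hom_axioms_def)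
    have "snd ?zt = snd x" using sh.hom_nat_pow[OF zc, of t] t by (rule trans[OF _ sym])
    then have "snd ?n = snd x \<otimes>\<^bsub>?Z\<^esub> inv\<^bsub>?Z\<^esub> (snd x)"
      by (simp only: sh.hom_mult[OF xc S.inv_closed[OF ztc]] sh.hom_inv[OF ztc])
    then have "snd ?n = 0" using Z.r_inv[OF xs] by simp
    moreover have "?n \<in> carrier ?S" using xc ztc by simp
    ultimately have "?n \<in> ?M" unfolding Scar by (simp add: mem_Times_iff)
    moreover have "x = ?n \<otimes>\<^bsub>?S\<^esub> ?zt"
      using S.inv_solve_right[OF S.m_closed[OF xc S.inv_closed[OF ztc]] xc ztc] by blast
    ultimately show "\<exists>n \<in> ?M. \<exists>j::nat. x = n \<otimes>\<^bsub>?S\<^esub> z [^]\<^bsub>?S\<^esub> j"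
      by (intro bexI[of _ ?n] exI[of _ t])
  qed
qed

section \<open>The rank of a subgroup of a group with a scalar kernel\<close>

text \<open>
  When \<open>H \<langle>x\<rangle>\<close> is a group and \<open>x\<close> is not in \<open>H\<close>, the products \<open>h \<otimes> x [^] i\<close> with \<open>i < r\<close> list its elements
  without repetition.
\<close>

lemma (in group) card_generate_insert:
  fixes r :: nat
  assumes fin: "finite (carrier G)" and H: "subgroup H G" and x: "x \<in> carrier G"
    and r: "Factorial_Ring.prime r" "x [^] r = \<one>" and sub: "subgroup (H <#> generate G {x}) G"
  shows "card (generate G (insert x H)) \<in> {card H, card H * r}"
proof (cases "x \<in> H")
  case True
  then have "generate G (insert x H) = H"
    using generateI[OF H] by (metis insert_absorb subset_refl)
  then show ?thesis by simp
next
  case False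
  have Hc: "H \<subseteq> carrier G" using subgroup.subset[OF H] .
  have r0: "0 < r" using prime_gt_0_nat[OF r(1)] .
  let ?K = "H <#> generate G {x}"
  let ?f = "\<lambda>(h, i). h \<otimes> x [^] (i::nat)"
  have xmod: "x [^] (i mod r) = x [^] i" for i :: nat
  proof -
    have "x [^] i = (x [^] r) [^] (i div r) \<otimes> x [^] (i mod r)"
      using x by (simp add: nat_pow_pow nat_pow_mult)
    then show ?thesis using r x by simp
  qed
  have K: "?K = ?f ` (H \<times> {..<r})"
  proof (intro equalityI subsetI)
    fix z assume "z \<in> ?K"
    then obtain h u where h: "h \<in> H" "u \<in> generate G {x}" "z = h \<otimes> u" unfolding set_mult_def by blast
    obtain i :: nat where "u = x [^] i" using generate_singleton_nat[OF fin x h(2)] by blast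
    then have "z = ?f (h, i mod r)" using h xmod by simp
    then show "z \<in> ?f ` (H \<times> {..<r})" using h r0 by (intro image_eqI[of _ _ "(h, i mod r)"]) auto
  qed (use nat_pow_in_generate[OF x] in \<open>auto simp: set_mult_def\<close>)
  have "inj_on ?f (H \<times> {..<r})"
  proof (rule inj_onI)
    fix s t assume st: "s \<in> H \<times> {..<r}" "t \<in> H \<times> {..<r}" and eq: "?f s = ?f t"
    obtain g i h j where s: "s = (g, i)" "g \<in> H" "i < r" and t: "t = (h, j)" "h \<in> H" "j < r"
      using st by auto
    have gc: "g \<in> carrier G" and hc: "h \<in> carrier G" using s t Hc by blast+
    have eq': "g \<otimes> x [^] int i = h \<otimes> x [^] int j" using eq s t by (simp add: int_pow_int)
    have "x [^] (int j - int i) = x [^] int j \<otimes> inv (x [^] int i)" using int_pow_diff[OF x] .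
    also have "\<dots> = inv h \<otimes> g" using cross_cancel[OF _ _ _ _ eq'] gc hc x by simp
    also have "\<dots> \<in> H" using subgroup.m_closed[OF H subgroup.m_inv_closed[OF H t(2)] s(2)] .
    finally have "int r dvd int j - int i"
      using subgroup_mem_if_pow_mem[OF H x r] False by blast
    then have ij: "i = j" using s t dvd_imp_le_int[of "int j - int i" "int r"] by linarith
    then have "g = h" using eq' gc hc x by simp
    then show "s = t" using s t ij by simp
  qed
  then have "card ?K = card H * r"
    unfolding K by (simp add: card_image card_cartesian_product)
  moreover have "generate G (insert x H) = ?K"
  proof (rule equalityI)
    have one: "\<one> \<in> H" using subgroup.one_closed[OF H] .
    have "h \<in> ?K" if "h \<in> H" for h
      using that Hc r0 unfolding K by (intro image_eqI[of _ _ "(h, 0)"]) auto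
    moreover have "x = \<one> \<otimes> x" using x by simp
    then have "x \<in> ?K" using one unfolding set_mult_def by (blast intro: generate.incl)
    ultimately show "generate G (insert x H) \<subseteq> ?K"
      by (intro generate_subgroup_incl sub) auto
    have sg: "subgroup (generate G (insert x H)) G" using x Hc by (intro generate_is_subgroup) auto
    have "generate G {x} \<subseteq> generate G (insert x H)" by (rule mono_generate) auto
    moreover have "H \<subseteq> generate G (insert x H)" by (auto intro: generate.incl)
    ultimately show "?K \<subseteq> generate G (insert x H)"
      unfolding set_mult_def using subgroup.m_closed[OF sg] by blast
  qed
  ultimately show ?thesis by simp
qed

text \<open>
  The product \<open>H \<langle>x\<rangle>\<close> is a group as soon as one factor is normal. For \<open>x\<close> in \<open>N\<close> this is \<open>\<langle>x\<rangle>\<close>, and for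
  \<open>H \<subseteq> N\<close> it is \<open>H\<close>. Otherwise \<open>H\<close> has an element \<open>z\<close> outside \<open>N\<close>, and modulo a power of \<open>z\<close> the element \<open>x\<close> can be
  replaced by an element of \<open>N\<close>.
\<close>

lemma (in group) scalar_kernel_card_generate_insert:
  assumes fin: "finite (carrier G)" and sk: "scalar_kernel G N" and H: "subgroup H G" and x: "x \<in> carrier G"
  shows "\<exists>r::nat. Factorial_Ring.prime r \<and> card (generate G (insert x H)) \<in> {card H, card H * r}"
proof -
  note subN = scalar_kernelD(1)[OF sk] and Nc = scalar_kernelD(5)[OF sk]
  have Hc: "H \<subseteq> carrier G" using subgroup.subset[OF H] .
  have normal_in_N: "K \<lhd> G" if K: "subgroup K G" "K \<subseteq> N" for K
    by (rule normal_if_conj_powers[OF K(1)]) (use scalar_kernelD(3)[OF sk] K(2) in blast)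
  have normal_case: ?thesis if "subgroup (H <#> generate G {x}) G"
  proof -
    obtain r :: nat where r: "Factorial_Ring.prime r" "x [^] r = \<one>"
      using scalar_kernelD(2)[OF sk x] by blast
    show ?thesis using card_generate_insert[OF fin H x r that] r(1) by blast
  qed
  have kernel_case: "\<exists>r::nat. Factorial_Ring.prime r \<and> card (generate G (insert n H)) \<in> {card H, card H * r}"
    if n: "n \<in> N" for n
  proof -
    have nc: "n \<in> carrier G" using Nc[OF n] .
    have sn: "subgroup (generate G {n}) G" using nc by (intro generate_is_subgroup) auto
    have "generate G {n} \<subseteq> N" using n by (intro generate_subgroup_incl subN) auto
    then have nn: "generate G {n} \<lhd> G" using normal_in_N[OF sn] by blast
    have "subgroup (generate G {n} <#> H) G" by (rule mult_norm_subgroup[OF nn H])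
    then have "subgroup (H <#> generate G {n}) G" using commut_normal[OF H nn] by simp
    moreover obtain r :: nat where r: "Factorial_Ring.prime r" "n [^] r = \<one>"
      using scalar_kernelD(2)[OF sk nc] by blast
    ultimately show ?thesis using card_generate_insert[OF fin H nc r] by blast
  qed
  show ?thesis
  proof (cases "x \<in> N")
    case True
    then show ?thesis by (rule kernel_case)
  next
    case xN: False
    show ?thesis
    proof (cases "H \<subseteq> N")
      case True
      have "subgroup (generate G {x}) G" using x by (intro generate_is_subgroup) auto
      then have "subgroup (H <#> generate G {x}) G"
        by (rule mult_norm_subgroup[OF normal_in_N[OF H True]])
      then show ?thesis by (rule normal_case)
    next
      case False
      then obtain z where z: "z \<in> H" "z \<notin> N" by blast
      have zc: "z \<in> carrier G" using z Hc by blast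
      obtain n and j :: nat where n: "n \<in> N" "x = n \<otimes> z [^] j"
        using scalar_kernelD(4)[OF sk x xN zc z(2)] by blast
      have nc: "n \<in> carrier G" using Nc[OF n(1)] .
      have zj: "z [^] j \<in> H"
        using subgroup_int_pow_closed[OF H z(1), of "int j"] by (simp add: int_pow_int)
      have sx: "subgroup (generate G (insert x H)) G" and sn: "subgroup (generate G (insert n H)) G"
        using x nc Hc by (auto intro!: generate_is_subgroup)
      have "n = x \<otimes> inv (z [^] j)" using n zc nc by (simp add: m_assoc)
      moreover have "x \<in> generate G (insert x H)" "z [^] j \<in> generate G (insert x H)"
        using zj by (auto intro: generate.incl)
      ultimately have "n \<in> generate G (insert x H)"
        using subgroup.m_closed[OF sx] subgroup.m_inv_closed[OF sx] by metis
      moreover have "n \<in> generate G (insert n H)" "z [^] j \<in> generate G (insert n H)"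
        using zj by (auto intro: generate.incl)
      then have "x \<in> generate G (insert n H)"
        unfolding n(2) by (rule subgroup.m_closed[OF sn])
      ultimately have "generate G (insert x H) = generate G (insert n H)"
        by (intro equalityI generate_subgroup_incl sx sn) (auto intro: generate.incl)
      then show ?thesis using kernel_case[OF n(1)] by simp
    qed
  qed
qed

lemma size_prime_factorization_mult_prime:
  fixes a r :: nat
  assumes "0 < a" "Factorial_Ring.prime r"
  shows "size (prime_factorization (a * r)) = Suc (size (prime_factorization a))"
  using assms by (subst prime_factorization_mult) (auto simp: prime_factorization_prime prime_gt_0_nat)

lemma size_prime_factorization_less:
  fixes a b :: nat
  assumes "a dvd b" "a < b"
  shows "size (prime_factorization a) < size (prime_factorization b)"
proof -
  obtain c where c: "b = a * c" using assms(1) by blast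
  have "b \<noteq> 0" using assms(2) by simp
  then have "a \<noteq> 0" "c \<noteq> 0" using c by auto
  moreover have "c \<noteq> 1" using assms c by auto
  ultimately have "prime_factorization c \<noteq> {#}"
    by (simp add: prime_factorization_empty_iff)
  then show ?thesis
    using \<open>a \<noteq> 0\<close> \<open>c \<noteq> 0\<close> unfolding c
    by (simp add: prime_factorization_mult nonempty_has_size)
qed

lemma (in group) card_subgroup_dvd:
  assumes "finite (carrier G)" "subgroup H G" "subgroup K G" "H \<subseteq> K"
  shows "card H dvd card K"
proof -
  interpret K: group "G\<lparr>carrier := K\<rparr>" using subgroup.subgroup_is_group[OF assms(3) is_group] .
  have "subgroup H (G\<lparr>carrier := K\<rparr>)" using subgroup_incl[OF assms(2-4)] .
  from K.lagrange[OF this] have "card K = card (rcosets\<^bsub>G\<lparr>carrier := K\<rparr>\<^esub> H) * card H"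
    by (simp add: order_def)
  then show ?thesis by (rule dvdI[OF trans]) (rule mult.commute)
qed

lemma (in group) generate_insert_generate:
  assumes "S \<subseteq> carrier G" "x \<in> carrier G"
  shows "generate G (insert x (generate G S)) = generate G (insert x S)"
proof (intro equalityI generate_subgroup_incl generate_is_subgroup)
  have "generate G S \<subseteq> generate G (insert x S)" by (rule mono_generate) auto
  then show "insert x (generate G S) \<subseteq> generate G (insert x S)" by (auto intro: generate.incl)
  show "insert x S \<subseteq> generate G (insert x (generate G S))" by (auto intro: generate.incl)
  show "insert x S \<subseteq> carrier G" "insert x (generate G S) \<subseteq> carrier G"
    using assms generate_incl[OF assms(1)] by auto
qed

lemma (in group) scalar_kernel_rank_le:
  assumes fin: "finite (carrier G)" and sk: "scalar_kernel G N" and S: "finite S" "S \<subseteq> carrier G"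
  shows "size (prime_factorization (card (generate G S))) \<le> card S"
  using S
proof (induction S rule: finite_induct)
  case empty
  then show ?case by (simp add: generate_empty)
next
  case (insert x S)
  let ?H = "generate G S"
  have sub: "subgroup ?H G" using insert.prems by (intro generate_is_subgroup) auto
  have pos: "0 < card ?H"
    using subgroup.one_closed[OF sub] finite_subset[OF subgroup.subset[OF sub] fin] card_gt_0_iff by blast
  obtain r :: nat where r: "Factorial_Ring.prime r" "card (generate G (insert x ?H)) \<in> {card ?H, card ?H * r}"
    using scalar_kernel_card_generate_insert[OF fin sk sub, of x] insert.prems by blast
  have "size (prime_factorization (card (generate G (insert x ?H)))) \<le> Suc (size (prime_factorization (card ?H)))"
    using r size_prime_factorization_mult_prime[OF pos r(1)] by auto
  then show ?case
    using generate_insert_generate[of S x] insert by simp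
qed

lemma (in group) strict_chain_length_le_rank:
  assumes fin: "finite (carrier G)"
  shows "strict_chain G xs \<Longrightarrow> length xs \<le> size (prime_factorization (card (generate G (set xs))))"
proof (induction xs rule: rev_induct)
  case (snoc x xs)
  have ch: "strict_chain G xs" and x: "x \<in> carrier G" "x \<notin> generate G (set xs)"
    using snoc.prems strict_chain_snoc by blast+
  have xs: "set xs \<subseteq> carrier G" using ch by (simp add: strict_chain_def)
  have subs: "subgroup (generate G (set xs)) G" "subgroup (generate G (set (xs @ [x]))) G"
    using xs x by (auto intro!: generate_is_subgroup)
  have le: "generate G (set xs) \<subseteq> generate G (set (xs @ [x]))" by (rule mono_generate) auto
  moreover have "x \<in> generate G (set (xs @ [x]))" by (simp add: generate.incl)
  ultimately have "card (generate G (set xs)) < card (generate G (set (xs @ [x])))"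
    using x(2) finite_subset[OF subgroup.subset[OF subs(2)] fin] by (intro psubset_card_mono) auto
  then have "size (prime_factorization (card (generate G (set xs))))
      < size (prime_factorization (card (generate G (set (xs @ [x])))))"
    using size_prime_factorization_less card_subgroup_dvd[OF fin subs le] by blast
  then show ?case using snoc.IH[OF ch] by simp
qed simp

text \<open>
  A minimal generating set bounds the rank of \<open>G\<close> from above by the length of the chain, and the strict steps
  of the chain bound the rank of the subgroup that it generates from below by the same length.
\<close>

lemma (in group) scalar_kernel_imp_uniformly_generated:
  assumes fin: "finite (carrier G)" and sk: "scalar_kernel G N"
  shows "uniformly_generated G"
  unfolding uniformly_generated_iff_strict_chain
proof (intro allI impI, rule ccontr)
  fix xs assume xs: "strict_chain G xs \<and> length xs = min_generators G"
    and ne: "generate G (set xs) \<noteq> carrier G"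
  have xc: "set xs \<subseteq> carrier G" using xs by (simp add: strict_chain_def)
  have sub: "subgroup (generate G (set xs)) G" using xc by (rule generate_is_subgroup)
  note le = subgroup.subset[OF sub]
  have "generate G (carrier G) = carrier G" using generateI[OF subgroup_self] by simp
  then have "\<exists>n. \<exists>S. S \<subseteq> carrier G \<and> finite S \<and> card S = n \<and> generate G S = carrier G"
    using fin by (intro exI[of _ "card (carrier G)"] exI[of _ "carrier G"]) simp
  from LeastI_ex[OF this] obtain S where
    S: "S \<subseteq> carrier G" "finite S" "card S = min_generators G" "generate G S = carrier G"
    unfolding min_generators_def[symmetric] by blast
  have "size (prime_factorization (card (carrier G))) \<le> min_generators G"
    using scalar_kernel_rank_le[OF fin sk S(2,1)] S by simp
  also have "\<dots> \<le> size (prime_factorization (card (generate G (set xs))))"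
    using strict_chain_length_le_rank[OF fin, of xs] xs by simp
  also have "\<dots> < size (prime_factorization (card (carrier G)))"
    using card_subgroup_dvd[OF fin sub subgroup_self le] ne le fin
    by (intro size_prime_factorization_less psubset_card_mono) auto
  finally show False by simp
qed

section \<open>The characterization\<close>

lemma (in group) uniformly_generated_if_iso_scalar_kernel:
  assumes "finite (carrier G)" "group S" "scalar_kernel S M" "G \<cong> S"
  shows "uniformly_generated G"
proof -
  obtain h where "h \<in> iso G S" using assms(4) by (auto simp: is_iso_def)
  then show ?thesis
    using scalar_kernel_imp_uniformly_generated[OF assms(1)]
      scalar_kernel_iso_transfer[OF is_group assms(2) _ assms(3)] by blast
qed

theorem theorem1p1:
  fixes G :: "('a, 'b) monoid_scheme"
  assumes "group G" and "finite (carrier G)"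
  shows "uniformly_generated G \<longleftrightarrow>
    (\<exists>(p::nat) (d::nat). Factorial_Ring.prime p \<and> G \<cong> cyclic_power p d) \<or>
    (\<exists>(p::nat) (q::nat) (d::nat) \<phi>. Factorial_Ring.prime p \<and> Factorial_Ring.prime q \<and> d \<ge> 2 \<and>
       \<phi> \<in> hom (integer_mod_group q) (AutoGroup (cyclic_power p (d - 1))) \<and>
       acts_as_nontrivial_scalar p (d - 1) q \<phi> \<and>
       G \<cong> semidirect_product (cyclic_power p (d - 1)) (integer_mod_group q) \<phi>)"
proof -
  interpret group G by (rule assms(1))
  show ?thesis
  proof (rule iffI, goal_cases)
    case 1
    then obtain N where "scalar_kernel G N"
      using uniformly_generated_imp_scalar_kernel[OF assms(2)] by blast
    then show ?case by (rule scalar_kernel_classification[OF assms(2)])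
  next
    case 2
    then show ?case
    proof (elim disjE exE conjE)
      fix p d assume "Factorial_Ring.prime (p::nat)" "G \<cong> cyclic_power p d"
      then show ?thesis
        using uniformly_generated_if_iso_scalar_kernel[OF assms(2) group_cyclic_power scalar_kernel_cyclic_power]
        by blast
    next
      fix p q d \<phi>
      assume p: "Factorial_Ring.prime (p::nat)" and q: "Factorial_Ring.prime (q::nat)"
        and \<phi>: "\<phi> \<in> hom (integer_mod_group q) (AutoGroup (cyclic_power p (d - 1)))"
        and act: "acts_as_nontrivial_scalar p (d - 1) q \<phi>"
        and iso: "G \<cong> semidirect_product (cyclic_power p (d - 1)) (integer_mod_group q) \<phi>"
      show ?thesis
        using uniformly_generated_if_iso_scalar_kernel[OF assms(2) group_semidirect_product[OF group_cyclic_power group_integer_mod_group \<phi>]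
            scalar_kernel_semidirect_product[OF p q \<phi> act] iso] .
    qed
  qed
qed

end
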